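(* Let $\psi\in L^2(\mathbb{R}^3,\mathbb{C}^4)$ be a Dirac wavefunction and let $\varepsilon>0$. Then there are $v\in\,]0,1[$ and $\tau>0$ such that $\|1_{B_{v|t|}}\psi_t\|\le\varepsilon$ for all $t\in\mathbb{R}$ with $|t|\ge\tau$. In particular, for every radius $r>0$, $$1_{B_r}\psi_t\to0\quad\text{in } L^2(\mathbb{R}^3,\mathbb{C}^4)\ \text{ as } |t|\to\infty.$$
   Context: Fix a mass $m>0$ and Dirac matrices $\alpha_1,\alpha_2,\alpha_3,\beta$: Hermitian $4\times4$ complex matrices with $\alpha_j\alpha_k+\alpha_k\alpha_j=2\delta_{jk}I_4$, $\alpha_k\beta+\beta\alpha_k=0$, $\beta^2=I_4$. The free Dirac operator is the self-adjoint operator $H=\sum_{k=1}^3\alpha_k\frac{1}{\mathrm{i}}\partial_k+\beta m$ in $L^2(\mathbb{R}^3,\mathbb{C}^4)$ (equivalently $H=\mathcal{F}^{-1}h\mathcal{F}$, where $\mathcal{F}$ is the unitary Fourier transform and $h$ denotes multiplication by $h(p)=\sum_k\alpha_kp_k+\beta m$). A Dirac wavefunction is an element of $L^2(\mathbb{R}^3,\mathbb{C}^4)$. For a Dirac wavefunction $\psi$ and $t\in\mathbb{R}$ put $\psi_t:=\mathrm{e}^{\mathrm{i}tH}\psi$. $B_r:=\{x\in\mathbb{R}^3:|x|\le r\}$, $1_\Delta$ is the indicator function of $\Delta$, and $\|\cdot\|$ is the $L^2$ norm. *)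

theory Defs
  imports "HOL-Analysis.Analysis"
begin

type_synonym spinor_field = "real^3 \<Rightarrow> complex^4"

section \<open>The Hilbert space of square-integrable spinor fields\<close>

text \<open>Elements of the Hilbert space are represented by Borel functions; every almost-everywhere
  class of Lebesgue measurable functions has such a representative. The norm on the type
  \<^typ>\<open>complex^4\<close> is the Hermitian one.\<close>

definition L2_fields :: "spinor_field set" where
  "L2_fields = {\<psi>. \<psi> \<in> borel_measurable lborel \<and> integrable lborel (\<lambda>x. (norm (\<psi> x))\<^sup>2)}"

definition L2_norm :: "spinor_field \<Rightarrow> real" where
  "L2_norm \<psi> = sqrt (LINT x|lborel. (norm (\<psi> x))\<^sup>2)"

text \<open>Membership is part of the notion of convergence, because the Bochner integral in the norm
  is 0 for non-integrable functions.\<close>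

definition L2_tendsto :: "('i \<Rightarrow> spinor_field) \<Rightarrow> spinor_field \<Rightarrow> 'i filter \<Rightarrow> bool" where
  "L2_tendsto f g F \<longleftrightarrow>
     (\<forall>i. f i \<in> L2_fields) \<and> g \<in> L2_fields \<and> ((\<lambda>i. L2_norm (\<lambda>x. f i x - g x)) \<longlongrightarrow> 0) F"

section \<open>The unitary Fourier transform\<close>

definition fourier_truncated :: "real \<Rightarrow> spinor_field \<Rightarrow> spinor_field" where
  "fourier_truncated R \<psi> = (\<lambda>p. (2 * pi) powr (-3/2) *\<^sub>R
     (LINT x:cball 0 R|lborel. exp (- (\<i> * of_real (p \<bullet> x))) *s \<psi> x))"

text \<open>Plancherel's definition: the limit in the mean of the truncated integrals. The choice
  operator only selects a representative of an almost-everywhere class.\<close>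

definition fourier :: "spinor_field \<Rightarrow> spinor_field" where
  "fourier \<psi> = (SOME \<phi>. L2_tendsto (\<lambda>R. fourier_truncated R \<psi>) \<phi> at_top)"

text \<open>The operator \<open>F\<^sup>-\<^sup>1 M F\<close>, with \<open>M\<close> standing for multiplication by a matrix-valued function;
  \<open>F\<^sup>-\<^sup>1\<close> is the inverse of the Fourier transform as a map on the Hilbert space.\<close>

definition fourier_multiplier :: "(real^3 \<Rightarrow> complex^4^4) \<Rightarrow> spinor_field \<Rightarrow> spinor_field" where
  "fourier_multiplier M \<psi> =
     (SOME \<phi>. \<phi> \<in> L2_fields \<and> (AE p in lborel. fourier \<phi> p = M p *v fourier \<psi> p))"

section \<open>The free Dirac operator and its unitary group\<close>

definition hermitian_matrix :: "complex^'n^'n \<Rightarrow> bool" where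
  "hermitian_matrix A \<longleftrightarrow> (\<forall>i j. A $ i $ j = cnj (A $ j $ i))"

definition dirac_matrices :: "(3 \<Rightarrow> complex^4^4) \<Rightarrow> complex^4^4 \<Rightarrow> bool" where
  "dirac_matrices \<alpha> \<beta> \<longleftrightarrow>
     (\<forall>k. hermitian_matrix (\<alpha> k)) \<and> hermitian_matrix \<beta> \<and>
     (\<forall>j k. \<alpha> j ** \<alpha> k + \<alpha> k ** \<alpha> j = (if j = k then mat 2 else 0)) \<and>
     (\<forall>k. \<alpha> k ** \<beta> + \<beta> ** \<alpha> k = 0) \<and>
     \<beta> ** \<beta> = mat 1"

definition dirac_symbol :: "(3 \<Rightarrow> complex^4^4) \<Rightarrow> complex^4^4 \<Rightarrow> real \<Rightarrow> real^3 \<Rightarrow> complex^4^4" where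
  "dirac_symbol \<alpha> \<beta> m p = (\<Sum>k\<in>UNIV. p $ k *\<^sub>R \<alpha> k) + m *\<^sub>R \<beta>"

text \<open>The self-adjoint operator \<open>H = F\<^sup>-\<^sup>1 h F\<close>, on its maximal domain.\<close>

definition dirac_domain :: "(3 \<Rightarrow> complex^4^4) \<Rightarrow> complex^4^4 \<Rightarrow> real \<Rightarrow> spinor_field set" where
  "dirac_domain \<alpha> \<beta> m =
     {\<psi> \<in> L2_fields. (\<lambda>p. dirac_symbol \<alpha> \<beta> m p *v fourier \<psi> p) \<in> L2_fields}"

definition dirac_operator ::
    "(3 \<Rightarrow> complex^4^4) \<Rightarrow> complex^4^4 \<Rightarrow> real \<Rightarrow> spinor_field \<Rightarrow> spinor_field" where
  "dirac_operator \<alpha> \<beta> m = fourier_multiplier (dirac_symbol \<alpha> \<beta> m)"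

definition matrix_exp :: "complex^'n^'n \<Rightarrow> complex^'n^'n" where
  "matrix_exp A = (\<Sum>n. (1 / fact n) *\<^sub>R (((\<lambda>B. A ** B) ^^ n) (mat 1)))"

text \<open>The operator \<open>e\<^sup>i\<^sup>t\<^sup>H\<close>. By the functional calculus, \<open>f(H) = F\<^sup>-\<^sup>1 f(h) F\<close> for
  \<open>H = F\<^sup>-\<^sup>1 h F\<close>, where \<open>f(h)\<close> is multiplication by the matrix function \<open>f(h(p))\<close>.\<close>

definition dirac_evolution ::
    "(3 \<Rightarrow> complex^4^4) \<Rightarrow> complex^4^4 \<Rightarrow> real \<Rightarrow> real \<Rightarrow> spinor_field \<Rightarrow> spinor_field" where
  "dirac_evolution \<alpha> \<beta> m t =
     fourier_multiplier (\<lambda>p. matrix_exp (mat (\<i> * of_real t) ** dirac_symbol \<alpha> \<beta> m p))"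

end

theory Submission
  imports Defs "HOL-Probability.Probability"
begin

text \<open>In momentum space the parts of positive and negative energy carry the phases
  \<open>exp (\<plusminus>i t E p)\<close>, so consider \<open>u\<^sub>t = F\<^sup>-\<^sup>1 (exp (i t E) f)\<close>. Translating momentum by \<open>e\<^sub>1 / t\<close>
  multiplies in position space by \<open>exp (- i x\<^sub>1 / t)\<close>, which is within \<open>v\<close> of 1 on the ball of
  radius \<open>v \<bar>t\<bar>\<close>, but it changes the phase \<open>t E\<close> by the velocity \<open>p\<^sub>1 / E\<close> as \<open>t\<close> grows. Hence
  \<open>u\<^sub>t\<close> is small on that ball whenever \<open>f = (exp (i p\<^sub>1 / E) - 1) g\<close>, and such \<open>f\<close> are dense because
  the velocity vanishes only on a null set.\<close>

section \<open>Square-integrable spinor fields\<close>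

text \<open>In operator terms, conjugating multiplication by exp (- i x_1 / t) with the phase
  evolution gives unitary operators that converge strongly to multiplication by exp (i velocity).
  Strong convergence is what dominated convergence yields for an arbitrary square-integrable
  profile. It carries no uniform rate: \<open>v\<close> is of the order of the tolerance divided by
  the norm of g, and so depends on the field, as it must because small momenta move slowly. The two
  energies differ only by t -> -t, and the ball depends on t only through its modulus, so one
  estimate serves both. Before any of this, \<open>fourier\<close> and
  \<open>fourier_multiplier\<close> have to be brought to life: both are choices, so nothing is
  known about them until the limit in the mean exists and the transform is onto. This rests on
  Plancherel's identity for truncated fields. The obstacle there is that the squared transform is
  bounded but not known to be integrable, so Fubini does not apply to it directly; a Gaussian weight
  is inserted and afterwards removed by monotone convergence.\<close>

lemma norm_vector_smult:
  fixes c :: complex and v :: "complex^'n"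
  shows "norm (c *s v) = norm c * norm v"
  by (simp add: norm_vec_def norm_mult L2_set_right_distrib)

lemma bounded_bilinear_vector_smult:
  "bounded_bilinear (\<lambda>(c::complex) (v::complex^'n). c *s v)"
proof
  fix a a' :: complex and b b' :: "complex^'n" and r :: real
  show "(a + a') *s b = a *s b + a' *s b" by (simp add: vec_eq_iff distrib_right)
  show "a *s (b + b') = a *s b + a *s b'" by (simp add: vec_eq_iff distrib_left)
  show "(r *\<^sub>R a) *s b = r *\<^sub>R (a *s b)" by (simp add: vec_eq_iff)
  show "a *s (r *\<^sub>R b) = r *\<^sub>R (a *s b)" by (simp add: vec_eq_iff)
  show "\<exists>K. \<forall>a b. norm (a *s b :: complex^'n) \<le> norm a * norm b * K"
    by (rule exI[of _ 1]) (simp add: norm_vector_smult)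
qed

lemma borel_measurable_vector_smult [measurable (raw)]:
  fixes f :: "'a \<Rightarrow> complex" and g :: "'a \<Rightarrow> complex^'n"
  assumes [measurable]: "f \<in> borel_measurable M" "g \<in> borel_measurable M"
  shows "(\<lambda>x. f x *s g x) \<in> borel_measurable M"
  by (rule borel_measurable_continuous_Pair[OF assms])
     (intro bounded_bilinear.continuous_on[OF bounded_bilinear_vector_smult] continuous_intros)

lemma L2_fields_measurable: "f \<in> L2_fields \<Longrightarrow> f \<in> borel_measurable borel"
  by (simp add: L2_fields_def)

lemma L2_fields_integrable: "f \<in> L2_fields \<Longrightarrow> integrable lborel (\<lambda>x. (norm (f x))\<^sup>2)"
  by (simp add: L2_fields_def)

lemma L2_norm_nonneg [simp]: "0 \<le> L2_norm f"
  by (simp add: L2_norm_def)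

lemma L2_norm_square: "(L2_norm f)\<^sup>2 = (LINT x|lborel. (norm (f x))\<^sup>2)"
  by (simp add: L2_norm_def)

lemma L2_norm_minus_commute: "L2_norm (\<lambda>x. f x - g x) = L2_norm (\<lambda>x. g x - f x)"
  by (simp add: L2_norm_def norm_minus_commute)

lemma L2_norm_cong_AE:
  assumes "f \<in> borel_measurable borel" "g \<in> borel_measurable borel"
    and "AE x in lborel. norm (f x) = norm (g x)"
  shows "L2_norm f = L2_norm g"
  unfolding L2_norm_def using assms by (intro arg_cong[of _ _ sqrt] integral_cong_AE) auto

text \<open>Monotonicity of the integral applied to squares. Membership and norm bound are proved
  together because multiplication by indicators, phases and bounded coefficients needs both.\<close>

lemma L2_dominated:
  assumes f: "f \<in> L2_fields" and g[measurable]: "g \<in> borel_measurable borel"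
    and le: "AE x in lborel. norm (g x) \<le> C * norm (f x)" and C: "0 \<le> C"
  shows "g \<in> L2_fields" "L2_norm g \<le> C * L2_norm f"
proof -
  have le2: "AE x in lborel. (norm (g x))\<^sup>2 \<le> C\<^sup>2 * (norm (f x))\<^sup>2"
    using le by eventually_elim (metis norm_ge_zero power_mono power_mult_distrib)
  have i: "integrable lborel (\<lambda>x. C\<^sup>2 * (norm (f x))\<^sup>2)"
    using L2_fields_integrable[OF f] by simp
  have ig: "integrable lborel (\<lambda>x. (norm (g x))\<^sup>2)"
    by (rule Bochner_Integration.integrable_bound[OF i]) (use le2 in auto)
  then show "g \<in> L2_fields" by (simp add: L2_fields_def)
  have "(L2_norm g)\<^sup>2 \<le> (C * L2_norm f)\<^sup>2"
    unfolding L2_norm_square power_mult_distrib using integral_mono_AE[OF ig i le2] by simp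
  then show "L2_norm g \<le> C * L2_norm f"
    using C by (meson L2_norm_nonneg mult_nonneg_nonneg power2_le_imp_le)
qed

lemma L2_fields_add:
  assumes f: "f \<in> L2_fields" and g: "g \<in> L2_fields"
  shows "(\<lambda>x. f x + g x) \<in> L2_fields"
proof -
  note [measurable] = L2_fields_measurable[OF f] L2_fields_measurable[OF g]
  have "integrable lborel (\<lambda>x. 2 * (norm (f x))\<^sup>2 + 2 * (norm (g x))\<^sup>2)"
    using f g by (simp add: L2_fields_def)
  then have "integrable lborel (\<lambda>x. (norm (f x + g x))\<^sup>2)"
  proof (rule Bochner_Integration.integrable_bound)
    have "(norm (f x + g x))\<^sup>2 \<le> 2 * (norm (f x))\<^sup>2 + 2 * (norm (g x))\<^sup>2" for x
    proof -
      have "(norm (f x + g x))\<^sup>2 \<le> (norm (f x) + norm (g x))\<^sup>2"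
        by (intro power_mono norm_triangle_ineq) simp
      also have "\<dots> \<le> 2 * (norm (f x))\<^sup>2 + 2 * (norm (g x))\<^sup>2"
        \<comment> \<open>The cross term is absorbed by the nonnegative square of the difference of
          the two norms.\<close>
        using sum_squares_ge_zero[of "norm (f x) - norm (g x)" 0]
        by (simp add: power2_eq_square algebra_simps)
      finally show ?thesis .
    qed
    then show "AE x in lborel. norm ((norm (f x + g x))\<^sup>2) \<le> norm (2 * (norm (f x))\<^sup>2 + 2 * (norm (g x))\<^sup>2)"
      by (intro AE_I2) (simp add: order_trans[OF _ abs_ge_self])
  qed simp
  then show ?thesis by (simp add: L2_fields_def)
qed

lemma L2_fields_scaleR: "f \<in> L2_fields \<Longrightarrow> (\<lambda>x. c *\<^sub>R f x) \<in> L2_fields"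
  by (rule L2_dominated(1)[of f _ "\<bar>c\<bar>"]) (auto dest: L2_fields_measurable)

lemma L2_fields_diff:
  assumes "f \<in> L2_fields" "g \<in> L2_fields"
  shows "(\<lambda>x. f x - g x) \<in> L2_fields"
  using L2_fields_add[OF assms(1) L2_fields_scaleR[OF assms(2), of "-1"]] by simp

lemma L2_fields_zero: "(\<lambda>x. 0) \<in> L2_fields"
  by (simp add: L2_fields_def)

lemma L2_bounded_smult:
  assumes f: "f \<in> L2_fields" and c[measurable]: "c \<in> borel_measurable borel"
    and le: "\<And>x. norm (c x) \<le> C" and C: "0 \<le> C"
  shows "(\<lambda>x. c x *s f x) \<in> L2_fields" "L2_norm (\<lambda>x. c x *s f x) \<le> C * L2_norm f"
proof -
  note [measurable] = L2_fields_measurable[OF f]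
  have "AE x in lborel. norm (c x *s f x) \<le> C * norm (f x)"
    by (intro AE_I2) (simp add: norm_vector_smult le mult_right_mono)
  from L2_dominated[OF f _ this C]
  show "(\<lambda>x. c x *s f x) \<in> L2_fields" "L2_norm (\<lambda>x. c x *s f x) \<le> C * L2_norm f" by auto
qed

lemma L2_unimodular_smult:
  assumes f: "f \<in> L2_fields" and c: "c \<in> borel_measurable borel" and le: "\<And>x. norm (c x) = 1"
  shows "(\<lambda>x. c x *s f x) \<in> L2_fields" "L2_norm (\<lambda>x. c x *s f x) = L2_norm f"
  using L2_bounded_smult(1)[OF f c, of 1]
  by (simp_all add: le L2_norm_def norm_vector_smult)

lemma L2_indicator:
  assumes f: "f \<in> L2_fields" and [measurable]: "A \<in> sets borel"
  shows "(\<lambda>x. indicator A x *\<^sub>R f x) \<in> L2_fields"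
    "L2_norm (\<lambda>x. indicator A x *\<^sub>R f x) \<le> L2_norm f"
proof -
  note [measurable] = L2_fields_measurable[OF f]
  have "AE x in lborel. norm (indicator A x *\<^sub>R f x) \<le> 1 * norm (f x)"
    by (intro AE_I2) (simp split: split_indicator)
  from L2_dominated[OF f _ this]
  show "(\<lambda>x. indicator A x *\<^sub>R f x) \<in> L2_fields"
    "L2_norm (\<lambda>x. indicator A x *\<^sub>R f x) \<le> L2_norm f" by auto
qed

section \<open>The real inner product, Cauchy-Schwarz and limits in the norm\<close>

lemma L2_inner_integrable:
  assumes f: "f \<in> L2_fields" and g: "g \<in> L2_fields"
  shows "integrable lborel (\<lambda>x. f x \<bullet> g x)"
proof -
  note [measurable] = L2_fields_measurable[OF f] L2_fields_measurable[OF g]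
  \<comment> \<open>Polarization reduces the claim to closure under addition. On
    \<open>complex^4\<close> the product \<open>\<bullet>\<close> is the real part of the Hermitian
    one.\<close>
  have *: "f x \<bullet> g x = ((norm (f x + g x))\<^sup>2 - (norm (f x))\<^sup>2 - (norm (g x))\<^sup>2) / 2" for x
    by (simp add: power2_norm_eq_inner inner_simps inner_commute)
  show ?thesis unfolding *
    using L2_fields_integrable[OF L2_fields_add[OF f g]] f g by (simp add: L2_fields_def)
qed

lemma L2_norm_add_square:
  assumes f: "f \<in> L2_fields" and g: "g \<in> L2_fields"
  shows "(L2_norm (\<lambda>x. f x + g x))\<^sup>2 =
    (L2_norm f)\<^sup>2 + 2 * (LINT x|lborel. f x \<bullet> g x) + (L2_norm g)\<^sup>2"
proof -
  have "(norm (f x + g x))\<^sup>2 = (norm (f x))\<^sup>2 + 2 * (f x \<bullet> g x) + (norm (g x))\<^sup>2" for x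
    by (simp add: power2_norm_eq_inner inner_simps inner_commute)
  then show ?thesis
    using L2_inner_integrable[OF f g] f g
    by (simp add: L2_norm_square L2_fields_def)
qed

lemma L2_norm_scaleR: "L2_norm (\<lambda>x. c *\<^sub>R f x) = \<bar>c\<bar> * L2_norm f"
  by (simp add: L2_norm_def power_mult_distrib real_sqrt_mult)

lemma L2_norm_eq_0_AE:
  assumes f: "f \<in> L2_fields" and 0: "L2_norm f = 0"
  shows "AE x in lborel. f x = 0"
proof -
  have "(LINT x|lborel. (norm (f x))\<^sup>2) = 0" using 0 by (simp add: L2_norm_def)
  then have "AE x in lborel. (norm (f x))\<^sup>2 = 0"
    using integral_nonneg_eq_0_iff_AE[OF L2_fields_integrable[OF f]] by simp
  then show ?thesis by simp
qed

lemma L2_norm_diff_square: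
  assumes f: "f \<in> L2_fields" and g: "g \<in> L2_fields"
  shows "(L2_norm (\<lambda>x. f x - g x))\<^sup>2 =
    (L2_norm f)\<^sup>2 - 2 * (LINT x|lborel. f x \<bullet> g x) + (L2_norm g)\<^sup>2"
  using L2_norm_add_square[OF f L2_fields_scaleR[OF g, of "-1"]] L2_norm_scaleR[of "-1" g]
  by simp

lemma L2_Cauchy_Schwarz:
  assumes f: "f \<in> L2_fields" and g: "g \<in> L2_fields"
  shows "\<bar>LINT x|lborel. f x \<bullet> g x\<bar> \<le> L2_norm f * L2_norm g"
proof (cases "L2_norm f = 0 \<or> L2_norm g = 0")
  case True
  then have "AE x in lborel. f x \<bullet> g x = 0"
  proof
    assume "L2_norm f = 0"
    from L2_norm_eq_0_AE[OF f this] show ?thesis by eventually_elim simp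
  next
    assume "L2_norm g = 0"
    from L2_norm_eq_0_AE[OF g this] show ?thesis by eventually_elim simp
  qed
  then have "(LINT x|lborel. f x \<bullet> g x) = 0"
    by (rule integral_eq_zero_AE)
  then show ?thesis by simp
next
  case False
  define a b i where "a = L2_norm f" and "b = L2_norm g" and "i = (LINT x|lborel. f x \<bullet> g x)"
  have pos: "a > 0" "b > 0"
    using False L2_norm_nonneg unfolding a_def b_def by (metis order_le_less)+
  \<comment> \<open>Both scaled fields have norm \<open>a * b\<close>, so nonnegativity of the
    squared norms of their sum and of their difference bounds \<open>i\<close> from below and from
    above, after division by \<open>2 * a * b\<close>. This is why vanishing norms form a separate
    case.\<close>
  let ?f = "\<lambda>x. b *\<^sub>R f x" and ?g = "\<lambda>x. a *\<^sub>R g x"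
  have F: "?f \<in> L2_fields" "?g \<in> L2_fields" using f g by (auto intro: L2_fields_scaleR)
  have n: "L2_norm ?f = b * a" "L2_norm ?g = a * b"
    using pos by (simp_all add: L2_norm_scaleR a_def b_def)
  have e: "(LINT x|lborel. ?f x \<bullet> ?g x) = a * b * i"
    by (simp add: i_def mult.assoc mult.left_commute)
  have "0 \<le> (b * a)\<^sup>2 + 2 * (a * b * i) + (a * b)\<^sup>2"
    by (subst L2_norm_add_square[OF F, unfolded n e, symmetric]) simp
  moreover have "0 \<le> (b * a)\<^sup>2 - 2 * (a * b * i) + (a * b)\<^sup>2"
    by (subst L2_norm_diff_square[OF F, unfolded n e, symmetric]) simp
  ultimately have "0 \<le> (a * b) * (a * b + i)" "0 \<le> (a * b) * (a * b - i)"
    by (simp_all add: power2_eq_square algebra_simps del: mult_nonneg_nonneg)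
  then have "0 \<le> a * b + i" "0 \<le> a * b - i"
    using mult_pos_pos[OF pos] by (simp_all add: zero_le_mult_iff not_le[symmetric])
  then show ?thesis unfolding a_def b_def i_def by linarith
qed

lemma L2_norm_triangle:
  assumes f: "f \<in> L2_fields" and g: "g \<in> L2_fields"
  shows "L2_norm (\<lambda>x. f x + g x) \<le> L2_norm f + L2_norm g"
proof (rule power2_le_imp_le)
  show "(L2_norm (\<lambda>x. f x + g x))\<^sup>2 \<le> (L2_norm f + L2_norm g)\<^sup>2"
    using L2_Cauchy_Schwarz[OF f g]
    by (simp add: L2_norm_add_square[OF f g] power2_sum)
qed simp

lemma L2_norm_triangle_diff:
  assumes f: "f \<in> L2_fields" and g: "g \<in> L2_fields" and h: "h \<in> L2_fields"
  shows "L2_norm (\<lambda>x. f x - h x) \<le> L2_norm (\<lambda>x. f x - g x) + L2_norm (\<lambda>x. g x - h x)"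
  using L2_norm_triangle[OF L2_fields_diff[OF f g] L2_fields_diff[OF g h]] by simp

lemma L2_norm_diff_le:
  assumes f: "f \<in> L2_fields" and g: "g \<in> L2_fields"
  shows "\<bar>L2_norm f - L2_norm g\<bar> \<le> L2_norm (\<lambda>x. f x - g x)"
  using L2_norm_triangle[OF L2_fields_diff[OF f g] g] L2_norm_triangle[OF L2_fields_diff[OF g f] f]
    L2_norm_minus_commute[of f g] by simp

text \<open>This makes the choice in \<open>fourier\<close> harmless: any two limits in the mean
  agree almost everywhere.\<close>

lemma L2_limit_unique:
  assumes f: "\<And>i. f i \<in> L2_fields" and g: "g \<in> L2_fields" and h: "h \<in> L2_fields"
    and F: "F \<noteq> bot"
    and lim: "((\<lambda>i. L2_norm (\<lambda>x. f i x - g x)) \<longlongrightarrow> 0) F" "((\<lambda>i. L2_norm (\<lambda>x. f i x - h x)) \<longlongrightarrow> 0) F"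
  shows "AE x in lborel. g x = h x"
proof -
  have "L2_norm (\<lambda>x. g x - h x) \<le> L2_norm (\<lambda>x. f i x - g x) + L2_norm (\<lambda>x. f i x - h x)" for i
    using L2_norm_triangle_diff[OF g f h, of i] by (simp add: L2_norm_minus_commute[of g])
  with tendsto_add[OF lim] have "L2_norm (\<lambda>x. g x - h x) \<le> 0"
    using tendsto_lowerbound[of _ 0 F] F by (metis (no_types, lifting) add.right_neutral always_eventually)
  then have "L2_norm (\<lambda>x. g x - h x) = 0" by (simp add: antisym)
  from L2_norm_eq_0_AE[OF L2_fields_diff[OF g h] this] show ?thesis by simp
qed

lemma L2_norm_tendsto:
  assumes f: "\<And>i. f i \<in> L2_fields" and g: "g \<in> L2_fields"
    and lim: "((\<lambda>i. L2_norm (\<lambda>x. f i x - g x)) \<longlongrightarrow> 0) F"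
  shows "((\<lambda>i. L2_norm (f i)) \<longlongrightarrow> L2_norm g) F"
  by (rule Lim_transform[OF tendsto_const])
     (rule tendsto_0_le[OF lim, of _ 1], simp add: L2_norm_diff_le[OF g f] L2_norm_minus_commute[of g]
        L2_norm_diff_le[OF f g] abs_minus_commute[of "L2_norm g"])

text \<open>By polarization the inner product is a continuous function of three norms, and norms
  converge along limits in the mean.\<close>

lemma L2_inner_tendsto:
  assumes f: "\<And>i. f i \<in> L2_fields" "f' \<in> L2_fields" and g: "\<And>i. g i \<in> L2_fields" "g' \<in> L2_fields"
    and lim: "((\<lambda>i. L2_norm (\<lambda>x. f i x - f' x)) \<longlongrightarrow> 0) F" "((\<lambda>i. L2_norm (\<lambda>x. g i x - g' x)) \<longlongrightarrow> 0) F"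
  shows "((\<lambda>i. LINT x|lborel. f i x \<bullet> g i x) \<longlongrightarrow> (LINT x|lborel. f' x \<bullet> g' x)) F"
proof -
  have polar: "(LINT x|lborel. u x \<bullet> v x) = ((L2_norm (\<lambda>x. u x + v x))\<^sup>2 - (L2_norm u)\<^sup>2 - (L2_norm v)\<^sup>2) / 2"
    if "u \<in> L2_fields" "v \<in> L2_fields" for u v
    using L2_norm_add_square[OF that] by simp
  have "((\<lambda>i. L2_norm (\<lambda>x. (f i x + g i x) - (f' x + g' x))) \<longlongrightarrow> 0) F"
  proof (rule tendsto_0_le[OF tendsto_add[OF lim, simplified], of _ 1], intro always_eventually allI)
    fix i
    show "norm (L2_norm (\<lambda>x. (f i x + g i x) - (f' x + g' x))) \<le>
        norm (L2_norm (\<lambda>x. f i x - f' x) + L2_norm (\<lambda>x. g i x - g' x)) * 1"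
      using L2_norm_triangle[OF L2_fields_diff[OF f(1)[of i] f(2)] L2_fields_diff[OF g(1)[of i] g(2)]]
      by (simp add: algebra_simps)
  qed
  then have "((\<lambda>i. L2_norm (\<lambda>x. f i x + g i x)) \<longlongrightarrow> L2_norm (\<lambda>x. f' x + g' x)) F"
    by (intro L2_norm_tendsto L2_fields_add f g)
  then show ?thesis
    unfolding polar[OF f(1) g(1)] polar[OF f(2) g(2)]
    by (intro tendsto_divide tendsto_diff tendsto_power tendsto_const
        L2_norm_tendsto[OF f lim(1)] L2_norm_tendsto[OF g lim(2)]) simp_all
qed

section \<open>Convergence theorems and completeness\<close>

lemma L2_dominated_convergence:
  assumes h: "h \<in> L2_fields" and f: "\<And>n. f n \<in> borel_measurable borel" and g: "g \<in> borel_measurable borel"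
    and lim: "AE x in lborel. (\<lambda>n. f n x) \<longlonglongrightarrow> g x"
    and bd: "\<And>n. AE x in lborel. norm (f n x) \<le> norm (h x)"
  shows "(\<lambda>n. L2_norm (\<lambda>x. f n x - g x)) \<longlonglongrightarrow> 0"
proof -
  note [measurable] = f g L2_fields_measurable[OF h]
  \<comment> \<open>The limit inherits the bound by \<open>h\<close>, so each difference is at most
    twice \<open>norm (h x)\<close>; squaring gives the factor 4.\<close>
  have i: "integrable lborel (\<lambda>x. 4 * (norm (h x))\<^sup>2)"
    using L2_fields_integrable[OF h] by simp
  have all: "AE x in lborel. \<forall>n. norm (f n x) \<le> norm (h x)"
    using bd by (simp add: AE_all_countable)
  have gle: "AE x in lborel. norm (g x) \<le> norm (h x)"
    using lim all by eventually_elim (metis Lim_bounded tendsto_norm)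
  have "(\<lambda>n. LINT x|lborel. (norm (f n x - g x))\<^sup>2) \<longlonglongrightarrow> (LINT x|(lborel::(real^3) measure). 0)"
  proof (rule integral_dominated_convergence[where w = "\<lambda>x. 4 * (norm (h x))\<^sup>2"])
    show "AE x in lborel. (\<lambda>n. (norm (f n x - g x))\<^sup>2) \<longlonglongrightarrow> 0"
      using lim by eventually_elim (auto intro!: tendsto_eq_intros)
    show "AE x in lborel. norm ((norm (f n x - g x))\<^sup>2) \<le> 4 * (norm (h x))\<^sup>2" for n
      using all gle
    proof eventually_elim
      case (elim x)
      then have "norm (f n x - g x) \<le> 2 * norm (h x)"
        using norm_triangle_ineq4[of "f n x" "g x"] by (smt (verit))
      from power_mono[OF this, of 2] show ?case by (simp add: power_mult_distrib)
    qed
  qed (use i in \<open>auto simp del: integrable_mult_right_iff\<close>)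
  from tendsto_real_sqrt[OF this] show ?thesis by (simp add: L2_norm_def)
qed

text \<open>Fatou's lemma in the second index turns the Cauchy bound into a bound on the distance to
  the pointwise limit, which also puts \<open>g\<close> into the space. It serves completeness,
  where a subsequence converges, and the Fourier integral, where the pointwise limit is known
  explicitly.\<close>

lemma L2_Cauchy_pointwise_limit:
  assumes f: "\<And>n. f n \<in> L2_fields" and g[measurable]: "g \<in> borel_measurable borel"
    and lim: "AE x in lborel. (\<lambda>n. f n x) \<longlonglongrightarrow> g x"
    and Cauchy: "\<And>e. e > 0 \<Longrightarrow> \<exists>N. \<forall>m\<ge>N. \<forall>n\<ge>N. L2_norm (\<lambda>x. f m x - f n x) \<le> e"
  shows "g \<in> L2_fields" "(\<lambda>n. L2_norm (\<lambda>x. f n x - g x)) \<longlonglongrightarrow> 0"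
proof -
  note [measurable] = L2_fields_measurable[OF f]
  have *: "(\<lambda>x. f n x - g x) \<in> L2_fields \<and> L2_norm (\<lambda>x. f n x - g x) \<le> e"
    if e: "e > 0" and N: "\<forall>m\<ge>N. \<forall>n\<ge>N. L2_norm (\<lambda>x. f m x - f n x) \<le> e" and n: "n \<ge> N" for e n N
  proof -
    have "(\<integral>\<^sup>+x. ennreal ((norm (f n x - g x))\<^sup>2) \<partial>lborel) =
        (\<integral>\<^sup>+x. liminf (\<lambda>m. ennreal ((norm (f n x - f m x))\<^sup>2)) \<partial>lborel)"
    proof (rule nn_integral_cong_AE)
      show "AE x in lborel. ennreal ((norm (f n x - g x))\<^sup>2) = liminf (\<lambda>m. ennreal ((norm (f n x - f m x))\<^sup>2))"
        using lim
      proof eventually_elim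
        case (elim x)
        then have "(\<lambda>m. ennreal ((norm (f n x - f m x))\<^sup>2)) \<longlonglongrightarrow> ennreal ((norm (f n x - g x))\<^sup>2)"
          by (intro tendsto_ennrealI tendsto_intros)
        then show ?case by (rule lim_imp_Liminf[OF sequentially_bot, symmetric])
      qed
    qed
    also have "\<dots> \<le> liminf (\<lambda>m. \<integral>\<^sup>+x. ennreal ((norm (f n x - f m x))\<^sup>2) \<partial>lborel)"
      by (rule nn_integral_liminf) simp
    also have "\<dots> \<le> ennreal (e\<^sup>2)"
    proof (rule Liminf_le)
      have "(\<integral>\<^sup>+x. ennreal ((norm (f n x - f m x))\<^sup>2) \<partial>lborel) \<le> ennreal (e\<^sup>2)" if "m \<ge> N" for m
      proof -
        have "(\<integral>\<^sup>+x. ennreal ((norm (f n x - f m x))\<^sup>2) \<partial>lborel) = ennreal ((L2_norm (\<lambda>x. f n x - f m x))\<^sup>2)"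
          unfolding L2_norm_square
          by (rule nn_integral_eq_integral[OF L2_fields_integrable[OF L2_fields_diff[OF f f]]]) simp
        also have "\<dots> \<le> ennreal (e\<^sup>2)"
          using N n that by (intro ennreal_leI power_mono) auto
        finally show ?thesis .
      qed
      then show "\<forall>\<^sub>F m in sequentially. (\<integral>\<^sup>+x. ennreal ((norm (f n x - f m x))\<^sup>2) \<partial>lborel) \<le> ennreal (e\<^sup>2)"
        unfolding eventually_sequentially by blast
    qed (rule sequentially_bot)
    finally have le: "(\<integral>\<^sup>+x. ennreal ((norm (f n x - g x))\<^sup>2) \<partial>lborel) \<le> ennreal (e\<^sup>2)" .
    then have i: "integrable lborel (\<lambda>x. (norm (f n x - g x))\<^sup>2)"
      by (intro integrableI_bounded) (auto intro: le_less_trans[OF _ ennreal_less_top])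
    then have m: "(\<lambda>x. f n x - g x) \<in> L2_fields" by (simp add: L2_fields_def)
    have "ennreal ((L2_norm (\<lambda>x. f n x - g x))\<^sup>2) \<le> ennreal (e\<^sup>2)"
      unfolding L2_norm_square using le nn_integral_eq_integral[OF i] by simp
    then have "(L2_norm (\<lambda>x. f n x - g x))\<^sup>2 \<le> e\<^sup>2" by (simp add: ennreal_le_iff)
    then have "L2_norm (\<lambda>x. f n x - g x) \<le> e" by (rule power2_le_imp_le[OF _ less_imp_le[OF e]])
    with m show ?thesis by simp
  qed
  show g: "g \<in> L2_fields"
  proof -
    obtain N where "\<forall>m\<ge>N. \<forall>n\<ge>N. L2_norm (\<lambda>x. f m x - f n x) \<le> 1" using Cauchy[of 1] by auto
    from *[OF _ this, of N] have "(\<lambda>x. f N x - g x) \<in> L2_fields" by simp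
    from L2_fields_diff[OF f[of N] this] show ?thesis by simp
  qed
  show "(\<lambda>n. L2_norm (\<lambda>x. f n x - g x)) \<longlonglongrightarrow> 0"
  proof (rule LIMSEQ_I)
    fix r :: real assume "r > 0"
    then have r2: "r / 2 > 0" by simp
    obtain N where "\<forall>m\<ge>N. \<forall>n\<ge>N. L2_norm (\<lambda>x. f m x - f n x) \<le> r / 2" using Cauchy[OF r2] by auto
    from *[OF r2 this] have "\<forall>n\<ge>N. L2_norm (\<lambda>x. f n x - g x) \<le> r / 2" by simp
    then show "\<exists>no. \<forall>n\<ge>no. norm (L2_norm (\<lambda>x. f n x - g x) - 0) < r"
      using \<open>r > 0\<close> by (intro exI[of _ N]) fastforce
  qed
qed

text \<open>Riesz-Fischer: a subsequence with geometrically small steps converges almost everywhere,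
  and a Cauchy sequence converges along with its subsequence.\<close>

theorem L2_complete:
  assumes f: "\<And>n. f n \<in> L2_fields"
    and Cauchy: "\<And>e. e > 0 \<Longrightarrow> \<exists>N. \<forall>m\<ge>N. \<forall>n\<ge>N. L2_norm (\<lambda>x. f m x - f n x) \<le> e"
  shows "\<exists>g\<in>L2_fields. (\<lambda>n. L2_norm (\<lambda>x. f n x - g x)) \<longlonglongrightarrow> 0"
proof -
  note [measurable] = L2_fields_measurable[OF f]
  have "\<exists>N. \<forall>k. (\<forall>m\<ge>N k. \<forall>n\<ge>N k. L2_norm (\<lambda>x. f m x - f n x) \<le> (1/4)^k) \<and> N k < N (Suc k)"
  proof (rule dependent_nat_choice)
    show "\<exists>N. \<forall>m\<ge>N. \<forall>n\<ge>N. L2_norm (\<lambda>x. f m x - f n x) \<le> (1/4)^0"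
      using Cauchy[of 1] by simp
    fix M k
    obtain N where "\<forall>m\<ge>N. \<forall>n\<ge>N. L2_norm (\<lambda>x. f m x - f n x) \<le> (1/4)^Suc k"
      using Cauchy[of "(1/4)^Suc k"] by auto
    then show "\<exists>N. (\<forall>m\<ge>N. \<forall>n\<ge>N. L2_norm (\<lambda>x. f m x - f n x) \<le> (1/4)^Suc k) \<and> M < N"
      by (intro exI[of _ "max N (Suc M)"]) auto
  qed
  then obtain r where r: "\<And>k m n. m \<ge> r k \<Longrightarrow> n \<ge> r k \<Longrightarrow> L2_norm (\<lambda>x. f m x - f n x) \<le> (1/4)^k"
    and rs: "\<And>k. r k < r (Suc k)" by blast
  have sm: "strict_mono r" using rs by (simp add: strict_mono_Suc_iff)
  define d where "d k x = norm (f (r (Suc k)) x - f (r k) x)" for k x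
  have [measurable]: "d k \<in> borel_measurable borel" for k unfolding d_def by simp
  \<comment> \<open>The squared steps have integral at most (1/16)^k, so the weight
    \<open>4^k\<close> still leaves a convergent series. Where the weighted sum is finite, its terms
    are bounded, which forces \<open>d k x\<close> to decay like (1/2)^k.\<close>
  have "(\<integral>\<^sup>+x. (\<Sum>k. ennreal (4^k * (d k x)\<^sup>2)) \<partial>lborel) = (\<Sum>k. \<integral>\<^sup>+x. ennreal (4^k * (d k x)\<^sup>2) \<partial>lborel)"
    by (rule nn_integral_suminf) simp
  also have "\<dots> \<le> (\<Sum>k. ennreal ((1/4)^k))"
  proof (rule suminf_le)
    fix k
    have i: "integrable lborel (\<lambda>x. 4^k * (d k x)\<^sup>2)"
      unfolding d_def using L2_fields_integrable[OF L2_fields_diff[OF f[of "r (Suc k)"] f[of "r k"]]] by simp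
    have "(\<integral>\<^sup>+x. ennreal (4^k * (d k x)\<^sup>2) \<partial>lborel) = ennreal (4^k * (L2_norm (\<lambda>x. f (r (Suc k)) x - f (r k) x))\<^sup>2)"
      using nn_integral_eq_integral[OF i] by (simp add: L2_norm_square d_def)
    also have "\<dots> \<le> ennreal (4^k * ((1/4)^k)\<^sup>2)"
      by (intro ennreal_leI mult_left_mono power_mono r) (simp_all add: rs less_imp_le)
    also have "4^k * ((1/4)^k)\<^sup>2 = ((1/4)^k :: real)"
      by (simp add: power2_eq_square power_divide)
    finally show "(\<integral>\<^sup>+x. ennreal (4^k * (d k x)\<^sup>2) \<partial>lborel) \<le> ennreal ((1/4)^k)" .
  qed auto
  also have "\<dots> = ennreal (\<Sum>k. (1/4)^k)"
    by (rule suminf_ennreal2) (auto intro: summable_geometric)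
  also have "\<dots> < \<infinity>" by simp
  finally have "AE x in lborel. (\<Sum>k. ennreal (4^k * (d k x)\<^sup>2)) \<noteq> \<infinity>"
    by (intro nn_integral_PInf_AE) auto
  then have conv: "AE x in lborel. convergent (\<lambda>k. f (r k) x)"
  proof eventually_elim
    case (elim x)
    have s: "summable (\<lambda>k. 4^k * (d k x)\<^sup>2)"
      by (rule summable_suminf_not_top) (use elim in auto)
    then have "(\<lambda>k. 4^k * (d k x)\<^sup>2) \<longlonglongrightarrow> 0" by (rule summable_LIMSEQ_zero)
    then obtain K where K: "K > 0" "\<And>k. norm (4^k * (d k x)\<^sup>2) \<le> K"
      by (meson BseqE convergentI convergent_imp_Bseq)
    have dle: "norm (f (r (Suc k)) x - f (r k) x) \<le> sqrt K * (1/2)^k" for k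
    proof -
      have "(2^k * d k x)\<^sup>2 \<le> K"
      proof -
        have "((2::real)^k)\<^sup>2 = (2\<^sup>2)^k" by (metis power_mult mult.commute)
        then have "((2::real)^k)\<^sup>2 = 4^k" by simp
        then show ?thesis using K(2)[of k] by (simp add: power_mult_distrib)
      qed
      then have "2^k * d k x \<le> sqrt K" by (rule real_le_rsqrt)
      then show ?thesis by (simp add: d_def field_simps power_divide)
    qed
    have "summable (\<lambda>k. sqrt K * (1/2)^k)"
      by (intro summable_mult summable_geometric) simp
    then have "summable (\<lambda>k. f (r (Suc k)) x - f (r k) x)"
      by (rule summable_comparison_test'[where N = 0]) (rule dle)
    then have "convergent (\<lambda>n. \<Sum>k<n. f (r (Suc k)) x - f (r k) x)"
      by (simp add: summable_iff_convergent)
    then have "convergent (\<lambda>n. f (r n) x - f (r 0) x)"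
      using sum_lessThan_telescope[of "\<lambda>n. f (r n) x"] by simp
    from convergent_add[OF this convergent_const[of "f (r 0) x"]]
    show ?case by simp
  qed
  define g where "g x = lim (\<lambda>k. f (r k) x)" for x
  have gm: "g \<in> borel_measurable borel" unfolding g_def by measurable
  have lim: "AE x in lborel. (\<lambda>k. f (r k) x) \<longlonglongrightarrow> g x"
    using conv unfolding g_def convergent_LIMSEQ_iff .
  have C: "\<exists>N. \<forall>m\<ge>N. \<forall>n\<ge>N. L2_norm (\<lambda>x. f (r m) x - f (r n) x) \<le> e" if e: "e > 0" for e
  proof -
    obtain N where "\<forall>m\<ge>N. \<forall>n\<ge>N. L2_norm (\<lambda>x. f m x - f n x) \<le> e" using Cauchy[OF e] by auto
    then show ?thesis using seq_suble[OF sm] by (meson order_trans)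
  qed
  have g: "g \<in> L2_fields" and gl: "(\<lambda>k. L2_norm (\<lambda>x. f (r k) x - g x)) \<longlonglongrightarrow> 0"
    using L2_Cauchy_pointwise_limit[OF f gm lim C] by auto
  have "(\<lambda>n. L2_norm (\<lambda>x. f n x - g x)) \<longlonglongrightarrow> 0"
  proof (rule LIMSEQ_I)
    fix e :: real assume e: "e > 0"
    obtain N where N: "\<forall>m\<ge>N. \<forall>n\<ge>N. L2_norm (\<lambda>x. f m x - f n x) \<le> e/2" using Cauchy[of "e/2"] e by auto
    obtain M where M: "\<forall>k\<ge>M. norm (L2_norm (\<lambda>x. f (r k) x - g x)) < e/2"
      using LIMSEQ_D[OF gl, of "e/2"] e by auto
    define k where "k = max N M"
    have k: "r k \<ge> N" "k \<ge> M" using seq_suble[OF sm, of k] by (auto simp: k_def)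
    show "\<exists>no. \<forall>n\<ge>no. norm (L2_norm (\<lambda>x. f n x - g x) - 0) < e"
    proof (intro exI[of _ N] allI impI)
      fix n assume "n \<ge> N"
      with N k have "L2_norm (\<lambda>x. f n x - f (r k) x) \<le> e/2" by blast
      moreover have "L2_norm (\<lambda>x. f (r k) x - g x) < e/2" using M k by simp
      ultimately show "norm (L2_norm (\<lambda>x. f n x - g x) - 0) < e"
        using L2_norm_triangle_diff[OF f[of n] f[of "r k"] g] by simp
    qed
  qed
  with g show ?thesis by blast
qed

section \<open>The Fourier integral of integrable fields\<close>

text \<open>The transform as a pointwise integral, meaningful for integrable fields. Truncated
  transforms are its values on fields cut off to a ball, so statements about it are proved before
  the limit in the mean is taken.\<close>

definition fourier_integral :: "spinor_field \<Rightarrow> spinor_field" where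
  "fourier_integral f p = (2 * pi) powr (-3/2) *\<^sub>R
     (LINT x|lborel. exp (- (\<i> * of_real (p \<bullet> x))) *s f x)"

lemma norm_exp_minus_i [simp]: "norm (exp (- (\<i> * of_real r))) = 1"
  by (metis mult_minus_right norm_exp_i_times of_real_minus)

lemma vector_smult_scaleR_right:
  fixes v :: "complex^'n"
  shows "c *s (r *\<^sub>R v) = r *\<^sub>R (c *s v)"
  by (simp add: vec_eq_iff)

lemma fourier_truncated_eq:
  "fourier_truncated R f = fourier_integral (\<lambda>x. indicator (cball 0 R) x *\<^sub>R f x)"
  by (simp add: fourier_truncated_def fourier_integral_def set_lebesgue_integral_def
      vector_smult_scaleR_right fun_eq_iff)

lemma integrable_fourier_kernel:
  fixes f :: spinor_field
  assumes "integrable lborel f"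
  shows "integrable lborel (\<lambda>x. exp (- (\<i> * of_real (p \<bullet> x))) *s f x)"
proof (rule Bochner_Integration.integrable_bound[OF assms])
  have [measurable]: "f \<in> borel_measurable borel" using borel_measurable_integrable[OF assms] by simp
  show "(\<lambda>x. exp (- (\<i> * of_real (p \<bullet> x))) *s f x) \<in> borel_measurable lborel" by measurable
qed (simp add: norm_vector_smult)

lemma fourier_integral_measurable [measurable]:
  assumes [measurable]: "f \<in> borel_measurable borel"
  shows "fourier_integral f \<in> borel_measurable borel"
  unfolding fourier_integral_def by measurable

lemma norm_fourier_integral_le:
  "norm (fourier_integral f p) \<le> (2 * pi) powr (-3/2) * (LINT x|lborel. norm (f x))"
proof -
  have "norm (LINT x|lborel. exp (- (\<i> * of_real (p \<bullet> x))) *s f x) \<le>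
      (LINT x|lborel. norm (exp (- (\<i> * of_real (p \<bullet> x))) *s f x))"
    by (rule integral_norm_bound)
  then show ?thesis by (simp add: fourier_integral_def norm_vector_smult mult_left_mono)
qed

lemma fourier_integral_diff:
  assumes "integrable lborel f" "integrable lborel g"
  shows "fourier_integral (\<lambda>x. f x - g x) p = fourier_integral f p - fourier_integral g p"
proof -
  interpret bounded_bilinear "\<lambda>(c::complex) (v::complex^4). c *s v"
    by (rule bounded_bilinear_vector_smult)
  show ?thesis
    using Bochner_Integration.integral_diff[OF integrable_fourier_kernel[OF assms(1)] integrable_fourier_kernel[OF assms(2)]]
    by (simp add: fourier_integral_def diff_right scaleR_diff_right)
qed

text \<open>The double integrals below have unimodular kernels, so a product of two integrable
  functions of one variable each dominates them and Fubini applies.\<close>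

lemma integrable_pair_dominated:
  fixes h :: "'a::euclidean_space \<times> 'b::euclidean_space \<Rightarrow> 'c::{banach, second_countable_topology}"
  assumes f: "integrable lborel (f :: 'a \<Rightarrow> real)" and g: "integrable lborel (g :: 'b \<Rightarrow> real)"
    and h[measurable]: "h \<in> borel_measurable (lborel \<Otimes>\<^sub>M lborel)"
    and le: "\<And>x y. norm (h (x, y)) \<le> f x * g y"
  shows "integrable (lborel \<Otimes>\<^sub>M lborel) h"
proof (rule lborel_pair.Fubini_integrable)
  have i: "integrable lborel (\<lambda>y. h (x, y))" for x
    by (rule Bochner_Integration.integrable_bound[OF integrable_mult_right[OF g, of "f x"]])
      (use le in \<open>auto simp: abs_of_nonneg order_trans[OF norm_ge_zero le]\<close>)
  then show "AE x in lborel. integrable lborel (\<lambda>y. h (x, y))" by simp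
  show "integrable lborel (\<lambda>x. LINT y|lborel. norm (h (x, y)))"
  proof (rule Bochner_Integration.integrable_bound[OF integrable_mult_left[OF f, of "integral\<^sup>L lborel g"]])
    have "norm (LINT y|lborel. norm (h (x, y))) \<le> norm (f x * integral\<^sup>L lborel g)" for x
    proof -
      have "(LINT y|lborel. norm (h (x, y))) \<le> (LINT y|lborel. f x * g y)"
        by (intro integral_mono integrable_norm i integrable_mult_right g le)
      then show ?thesis by (simp add: order_trans[OF _ abs_ge_self])
    qed
    then show "AE x in lborel. norm (LINT y|lborel. norm (h (x, y))) \<le> norm (f x * integral\<^sup>L lborel g)"
      by simp
  qed measurable
qed simp

lemma vector_smult_inner:
  fixes a b :: "complex^'n"
  shows "(c *s a) \<bullet> b = a \<bullet> (cnj c *s b)"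
  by (simp add: inner_vec_def inner_complex_def algebra_simps)

text \<open>Fubini moves the kernel across the inner product, where it is conjugated. Conjugation
  amounts to replacing \<open>x\<close> by \<open>- x\<close>, so the adjoint is the same integral
  followed by a reflection.\<close>

theorem fourier_integral_adjoint:
  assumes f: "integrable lborel f" and g: "integrable lborel g"
  shows "(LINT p|lborel. fourier_integral f p \<bullet> g p) = (LINT x|lborel. f x \<bullet> fourier_integral g (- x))"
proof -
  have [measurable]: "f \<in> borel_measurable borel" "g \<in> borel_measurable borel"
    using borel_measurable_integrable[OF f] borel_measurable_integrable[OF g] by simp_all
  define c :: real where "c = (2 * pi) powr (-3/2)"
  let ?e = "\<lambda>p x :: real^3. exp (- (\<i> * of_real (p \<bullet> x)))"
  have swap: "(?e p x *s f x) \<bullet> g p = f x \<bullet> (?e (- x) p *s g p)" for p x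
    by (simp add: vector_smult_inner exp_cnj inner_commute[of p x])
  have i: "integrable (lborel \<Otimes>\<^sub>M lborel) (\<lambda>(x, p). (?e p x *s f x) \<bullet> g p)"
  proof (rule integrable_pair_dominated[OF integrable_norm[OF f] integrable_norm[OF g]])
    show "norm (case (x, p) of (x, p) \<Rightarrow> (?e p x *s f x) \<bullet> g p) \<le> norm (f x) * norm (g p)" for x p
      using Cauchy_Schwarz_ineq2[of "?e p x *s f x" "g p"] by (simp add: norm_vector_smult)
  qed measurable
  have "(LINT p|lborel. fourier_integral f p \<bullet> g p) =
      c * (LINT p|lborel. LINT x|lborel. (?e p x *s f x) \<bullet> g p)"
    using integrable_fourier_kernel[OF f]
    by (simp add: fourier_integral_def c_def)
  also have "\<dots> = c * (LINT x|lborel. LINT p|lborel. (?e p x *s f x) \<bullet> g p)"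
    using lborel_pair.Fubini_integral[OF i] by simp
  also have "\<dots> = c * (LINT x|lborel. LINT p|lborel. f x \<bullet> (?e (- x) p *s g p))"
    by (simp only: swap)
  also have "\<dots> = (LINT x|lborel. f x \<bullet> fourier_integral g (- x))"
    using integrable_fourier_kernel[OF g, of "- x" for x]
    by (simp add: fourier_integral_def c_def)
  finally show ?thesis .
qed

section \<open>The Gaussian\<close>

text \<open>Lebesgue measure is the image of the product measure over \<open>Basis\<close>; this
  reduces the Gaussian integrals to one dimension.\<close>

lemma
  fixes f :: "'a::euclidean_space \<Rightarrow> real \<Rightarrow> 'b::{real_normed_field, banach, second_countable_topology}"
  assumes f: "\<And>b. b \<in> Basis \<Longrightarrow> integrable lborel (f b)"
  shows lborel_integrable_prod_Basis: "integrable lborel (\<lambda>x::'a. \<Prod>b\<in>Basis. f b (x \<bullet> b))"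
    and lborel_integral_prod_Basis:
      "(LINT x|lborel. (\<Prod>b\<in>Basis. f b (x \<bullet> b))) = (\<Prod>b\<in>Basis. (LINT x|lborel. f b x))"
proof -
  interpret product_sigma_finite "\<lambda>_::'a. lborel :: real measure" ..
  have [measurable]: "f b \<in> borel_measurable borel" if "b \<in> Basis" for b
    using borel_measurable_integrable[OF f[OF that]] by simp
  have T[measurable]: "(\<lambda>g. \<Sum>b\<in>Basis. g b *\<^sub>R b) \<in> measurable (\<Pi>\<^sub>M b\<in>(Basis::'a set). lborel) borel"
    by measurable
  have F[measurable]: "(\<lambda>x::'a. \<Prod>b\<in>Basis. f b (x \<bullet> b)) \<in> borel_measurable borel"
    by (intro borel_measurable_prod) measurable
  have eq: "(\<Prod>b\<in>Basis. f b ((\<Sum>b\<in>Basis. g b *\<^sub>R b) \<bullet> b)) = (\<Prod>b\<in>Basis. f b (g b))" for g :: "'a \<Rightarrow> real"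
    by (intro prod.cong refl) simp
  show "integrable lborel (\<lambda>x::'a. \<Prod>b\<in>Basis. f b (x \<bullet> b))"
    unfolding lborel_eq[where 'a='a] integrable_distr_eq[OF T F] eq
    by (rule product_integrable_prod) (use f in auto)
  show "(LINT x|lborel. (\<Prod>b\<in>Basis. f b (x \<bullet> b))) = (\<Prod>b\<in>Basis. (LINT x|lborel. f b x))"
    unfolding lborel_eq[where 'a='a] integral_distr[OF T F] eq
    by (rule product_integral_prod) (use f in auto)
qed

lemma
  fixes F :: "'a::euclidean_space \<Rightarrow> 'b::{banach, second_countable_topology}"
  assumes F[measurable]: "F \<in> borel_measurable borel" and c: "c \<noteq> 0"
  shows lborel_integral_affine: "(LINT y|lborel. F y) = \<bar>c\<bar> ^ DIM('a) *\<^sub>R (LINT z|lborel. F (t + c *\<^sub>R z))"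
    and lborel_integrable_affine: "integrable lborel (\<lambda>z. F (t + c *\<^sub>R z)) \<longleftrightarrow> integrable lborel F"
proof -
  have c': "\<bar>c\<bar> ^ DIM('a) \<noteq> 0" using c by simp
  show "(LINT y|lborel. F y) = \<bar>c\<bar> ^ DIM('a) *\<^sub>R (LINT z|lborel. F (t + c *\<^sub>R z))"
    by (subst lborel_affine[OF c, of t]) (simp add: integral_density integral_distr)
  show "integrable lborel (\<lambda>z. F (t + c *\<^sub>R z)) \<longleftrightarrow> integrable lborel F"
  proof -
    have scale: "integrable M G" if "integrable M (\<lambda>x. a *\<^sub>R G x)" "a \<noteq> 0"
      for M and a :: real and G :: "'a \<Rightarrow> 'b"
      using integrable_scaleR_right[of "1 / a" M "\<lambda>x. a *\<^sub>R G x"] that by simp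
    show ?thesis
      by (subst(2) lborel_affine[OF c, of t])
        (use scale[OF _ c', of lborel "\<lambda>z. F (t + c *\<^sub>R z)"] in \<open>auto simp: integrable_density integrable_distr_eq\<close>)
  qed
qed

lemma norm_square_eq_sum_Basis: "(norm x)\<^sup>2 = (\<Sum>b\<in>Basis. (x \<bullet> b)\<^sup>2)"
  by (simp add: power2_norm_eq_inner euclidean_inner[of x x]) (simp add: power2_eq_square)

text \<open>The standard normal density in three dimensions. Its constant equals the normalization
  of \<open>fourier_integral\<close>, so the two cancel in the damped identity.\<close>

definition gaussian :: "real^3 \<Rightarrow> real" where
  "gaussian z = (2 * pi) powr (-3/2) * exp (- (norm z)\<^sup>2 / 2)"

lemma gaussian_pos: "gaussian z > 0"
  by (simp add: gaussian_def)

lemma gaussian_measurable [measurable]: "gaussian \<in> borel_measurable borel"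
  unfolding gaussian_def by measurable

lemma gaussian_eq_prod: "gaussian z = (\<Prod>b\<in>Basis. std_normal_density (z \<bullet> b))"
proof -
  have "(\<Prod>b\<in>Basis. std_normal_density (z \<bullet> b)) =
      (1 / sqrt (2 * pi)) ^ 3 * (\<Prod>b\<in>Basis. exp (- (z \<bullet> b)\<^sup>2 / 2))"
    by (simp add: std_normal_density_def prod.distrib prod_dividef power_divide)
  also have "(\<Prod>b\<in>Basis. exp (- (z \<bullet> b)\<^sup>2 / 2)) = exp (- (norm z)\<^sup>2 / 2)"
    by (simp add: exp_sum[symmetric] sum_negf sum_divide_distrib[symmetric]
        norm_square_eq_sum_Basis)
  also have "(1 / sqrt (2 * pi)) ^ 3 = (2 * pi) powr (-3/2)"
  proof -
    have "(1 / sqrt (2 * pi)) ^ 3 = ((2 * pi) powr (-1/2)) ^ 3"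
      by (simp add: powr_minus powr_half_sqrt inverse_eq_divide)
    also have "\<dots> = (2 * pi) powr (-3/2)"
      by (simp add: powr_power)
    finally show ?thesis .
  qed
  finally show ?thesis by (simp add: gaussian_def)
qed

lemma gaussian_integrable: "integrable lborel gaussian"
  unfolding gaussian_eq_prod[abs_def] by (rule lborel_integrable_prod_Basis) simp

lemma gaussian_integral: "(LINT z|lborel. gaussian z) = 1"
  unfolding gaussian_eq_prod by (subst lborel_integral_prod_Basis) simp_all

text \<open>In each coordinate the integral is the characteristic function of the standard normal
  distribution, evaluated at minus the coordinate of \<open>p\<close>.\<close>

lemma gaussian_fourier:
  "(LINT z|lborel. exp (- (\<i> * of_real (p \<bullet> z))) * of_real (gaussian z)) =
    complex_of_real (exp (- (norm p)\<^sup>2 / 2))"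
proof -
  let ?f = "\<lambda>b x. exp (- (\<i> * of_real ((p \<bullet> b) * x))) * complex_of_real (std_normal_density x)"
  have i: "integrable lborel (?f b)" for b
  proof (rule Bochner_Integration.integrable_bound)
    show "integrable lborel std_normal_density" by simp
  qed (auto simp: norm_mult simp del: of_real_mult)
  have char: "(LINT x|lborel. ?f b x) = complex_of_real (exp (- (p \<bullet> b)\<^sup>2 / 2))" for b
  proof -
    have "char std_normal_distribution (- (p \<bullet> b)) =
        (LINT x|lborel. std_normal_density x *\<^sub>R iexp (- (p \<bullet> b) * x))"
      unfolding char_def by (subst integral_density) (auto simp: normal_density_nonneg)
    also have "\<dots> = (LINT x|lborel. ?f b x)"
      by (intro Bochner_Integration.integral_cong refl) (simp add: scaleR_conv_of_real)
    finally show ?thesis by (simp add: char_std_normal_distribution)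
  qed
  have "exp (- (\<i> * of_real (p \<bullet> z))) * of_real (gaussian z) = (\<Prod>b\<in>Basis. ?f b (z \<bullet> b))" for z
  proof -
    have "exp (- (\<i> * of_real (p \<bullet> z))) = (\<Prod>b\<in>Basis. exp (- (\<i> * of_real ((p \<bullet> b) * (z \<bullet> b)))))"
      by (subst euclidean_inner) (simp add: exp_sum[symmetric] sum_negf sum_distrib_left)
    then show ?thesis by (simp add: gaussian_eq_prod prod.distrib)
  qed
  then have "(LINT z|lborel. exp (- (\<i> * of_real (p \<bullet> z))) * of_real (gaussian z)) =
      (\<Prod>b\<in>Basis. complex_of_real (exp (- (p \<bullet> b)\<^sup>2 / 2)))"
    using lborel_integral_prod_Basis[of ?f] i char by simp
  also have "\<dots> = complex_of_real (exp (- (norm p)\<^sup>2 / 2))"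
    by (simp add: of_real_prod[symmetric] exp_sum[symmetric] sum_negf sum_divide_distrib[symmetric]
        norm_square_eq_sum_Basis del: of_real_prod of_real_exp)
  finally show ?thesis .
qed

section \<open>Plancherel's identity for compactly supported fields\<close>

text \<open>Integrating the Gaussian-damped energy first over momentum leaves the autocorrelation of
  the field averaged against a Gaussian of width \<open>e\<close>.\<close>

lemma fourier_integral_gaussian_damped:
  assumes f: "integrable lborel f" and e: "e > 0"
  shows "(LINT p|lborel. (norm (fourier_integral f p))\<^sup>2 * exp (- (norm (e *\<^sub>R p))\<^sup>2 / 2)) =
    (LINT x|lborel. f x \<bullet> (LINT z|lborel. gaussian z *\<^sub>R f (x + e *\<^sub>R z)))"
    and "integrable lborel (\<lambda>p. (norm (fourier_integral f p))\<^sup>2 * exp (- (norm (e *\<^sub>R p))\<^sup>2 / 2))"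
proof -
  have [measurable]: "f \<in> borel_measurable borel" using borel_measurable_integrable[OF f] by simp
  define c :: real where "c = (2 * pi) powr (-3/2)"
  have c: "c > 0" and c_eq: "(2 * pi) powr (-(3/2)) = c" by (simp_all add: c_def)
  define w :: "real^3 \<Rightarrow> real" where "w p = exp (- (norm (e *\<^sub>R p))\<^sup>2 / 2)" for p
  have w_gauss: "w p = gaussian (e *\<^sub>R p) / c" for p
    using c by (simp add: w_def gaussian_def c_eq)
  have [measurable]: "w \<in> borel_measurable borel" unfolding w_def by measurable
  have wpos: "w p > 0" for p by (simp add: w_def)
  have iw: "integrable lborel w"
    unfolding w_gauss[abs_def]
    using lborel_integrable_affine[of gaussian e 0] gaussian_integrable e by simp
  define K where "K = c * (LINT x|lborel. norm (f x))"
  have K: "norm (fourier_integral f p) \<le> K" for p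
    unfolding K_def c_def by (rule norm_fourier_integral_le)
  have K0: "K \<ge> 0" using K[of 0] norm_ge_zero order_trans by blast
  show "integrable lborel (\<lambda>p. (norm (fourier_integral f p))\<^sup>2 * exp (- (norm (e *\<^sub>R p))\<^sup>2 / 2))"
    unfolding w_def[symmetric]
  proof (rule Bochner_Integration.integrable_bound[OF integrable_mult_right[OF iw, of "K\<^sup>2"]])
    have "norm ((norm (fourier_integral f p))\<^sup>2 * w p) \<le> norm (K\<^sup>2 * w p)" for p
      using power_mono[OF K, of p 2] wpos[of p] by (simp add: abs_mult mult_right_mono)
    then show "AE p in lborel. norm ((norm (fourier_integral f p))\<^sup>2 * w p) \<le> norm (K\<^sup>2 * w p)"
      by simp
  qed measurable
  \<comment> \<open>The identity is the adjoint relation tested against \<open>g\<close>. The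
    transform of \<open>f\<close> is so far only known to be bounded by \<open>K\<close>; the weight
    makes \<open>g\<close> integrable.\<close>
  define g where "g p = w p *\<^sub>R fourier_integral f p" for p
  have [measurable]: "g \<in> borel_measurable borel" unfolding g_def by measurable
  have ig: "integrable lborel g"
  proof (rule Bochner_Integration.integrable_bound[OF integrable_mult_right[OF iw, of K]])
    have "norm (g p) \<le> norm (K * w p)" for p
      using mult_left_mono[OF K, of "w p"] wpos[of p] K0 by (simp add: g_def abs_mult mult.commute)
    then show "AE p in lborel. norm (g p) \<le> norm (K * w p)" by simp
  qed measurable
  let ?e = "\<lambda>p x :: real^3. exp (- (\<i> * of_real (p \<bullet> x)))"
  \<comment> \<open>Rescaling momentum by \<open>1 / e\<close> gives the volume factor. The two
    factors \<open>1 / c\<close> arise from writing an exponential as a multiple of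
    \<open>gaussian\<close>, once before and once after it is transformed.\<close>
  have damped_kernel: "(LINT p|lborel. of_real (w p) * ?e p u) =
      of_real ((1 / e) ^ 3 / c\<^sup>2 * gaussian ((1 / e) *\<^sub>R u))" for u
  proof -
    have "(LINT p|lborel. of_real (w p) * ?e p u) =
        \<bar>1 / e\<bar> ^ DIM(real^3) *\<^sub>R (LINT q|lborel. of_real (w (0 + (1 / e) *\<^sub>R q)) * ?e (0 + (1 / e) *\<^sub>R q) u)"
      using e by (intro lborel_integral_affine) auto
    also have "(LINT q|lborel. of_real (w (0 + (1 / e) *\<^sub>R q)) * ?e (0 + (1 / e) *\<^sub>R q) u) =
        (LINT q|lborel. of_real (1 / c) * (?e ((1 / e) *\<^sub>R u) q * of_real (gaussian q)))"
      using e by (intro Bochner_Integration.integral_cong refl)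
        (simp add: w_gauss inner_commute)
    also have "\<dots> = of_real (1 / c) * (LINT q|lborel. ?e ((1 / e) *\<^sub>R u) q * of_real (gaussian q))"
      by (rule integral_mult_right_zero)
    also have "\<dots> = of_real (1 / c * (gaussian ((1 / e) *\<^sub>R u) / c))"
      unfolding gaussian_fourier using c by (simp add: gaussian_def c_eq)
    finally show ?thesis using e by (simp add: scaleR_conv_of_real power2_eq_square)
  qed
  \<comment> \<open>Integrating over momentum first leaves a Gaussian in \<open>y - x\<close> of
    width \<open>e\<close>. The normalizations of the two transforms contribute \<open>c\<close>
    squared, which cancels the denominator of \<open>damped_kernel\<close>, and the substitution
    \<open>y = x + e *\<^sub>R z\<close> absorbs the volume factor.\<close>
  have conv: "fourier_integral g (- x) = (LINT z|lborel. gaussian z *\<^sub>R f (x + e *\<^sub>R z))" for x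
  proof -
    let ?h = "\<lambda>p y. (of_real (w p) * ?e p (y - x)) *s f y"
    interpret smult: bounded_bilinear "\<lambda>(c::complex) (v::complex^4). c *s v"
      by (rule bounded_bilinear_vector_smult)
    have ih: "integrable (lborel \<Otimes>\<^sub>M lborel) (\<lambda>(p, y). ?h p y)"
    proof (rule integrable_pair_dominated[OF iw integrable_norm[OF f]])
      show "norm (case (p, y) of (p, y) \<Rightarrow> ?h p y) \<le> w p * norm (f y)" for p y
        using wpos[of p] by (simp add: norm_vector_smult norm_mult)
    qed measurable
    have mult: "?e (- x) p *s (w p *\<^sub>R (?e p y *s f y)) = ?h p y" for p y
    proof -
      have "?e (- x) p * ?e p y = ?e p (y - x)"
        by (simp add: exp_add[symmetric] inner_diff_right inner_commute[of x p] algebra_simps)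
      from this[symmetric] show ?thesis
        by (simp only:) (simp add: vec_eq_iff, simp add: scaleR_conv_of_real ac_simps)
    qed
    have "?e (- x) p *s g p = c *\<^sub>R (LINT y|lborel. ?h p y)" for p
    proof -
      have "bounded_linear (\<lambda>v::complex^4. ?e (- x) p *s (w p *\<^sub>R v))"
        by (intro bounded_linear_compose[OF smult.bounded_linear_right] bounded_linear_scaleR_right)
      from integral_bounded_linear[OF this integrable_fourier_kernel[OF f, of p]]
      have "(LINT y|lborel. ?h p y) = ?e (- x) p *s (w p *\<^sub>R (LINT y|lborel. ?e p y *s f y))"
        by (simp only: mult)
      moreover have "g p = c *\<^sub>R (w p *\<^sub>R (LINT y|lborel. ?e p y *s f y))"
        by (simp add: g_def fourier_integral_def c_def)
      ultimately show ?thesis by (simp only: vector_smult_scaleR_right)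
    qed
    then have "fourier_integral g (- x) = c *\<^sub>R (LINT p|lborel. c *\<^sub>R (LINT y|lborel. ?h p y))"
      by (simp add: fourier_integral_def c_eq)
    also have "\<dots> = c\<^sup>2 *\<^sub>R (LINT p|lborel. LINT y|lborel. ?h p y)"
      by (simp add: power2_eq_square)
    also have "(LINT p|lborel. LINT y|lborel. ?h p y) = (LINT y|lborel. LINT p|lborel. ?h p y)"
      using lborel_pair.Fubini_integral[OF ih] by simp
    also have "\<dots> = (LINT y|lborel. ((1 / e) ^ 3 / c\<^sup>2) *\<^sub>R (gaussian ((1 / e) *\<^sub>R (y - x)) *\<^sub>R f y))"
    proof (intro Bochner_Integration.integral_cong refl)
      fix y
      have "integrable lborel (\<lambda>p. of_real (w p) * ?e p (y - x))"
        by (rule Bochner_Integration.integrable_bound[OF iw]) (auto simp: norm_mult)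
      from integral_bounded_linear[OF smult.bounded_linear_left this, of "f y"]
      show "(LINT p|lborel. ?h p y) = ((1 / e) ^ 3 / c\<^sup>2) *\<^sub>R (gaussian ((1 / e) *\<^sub>R (y - x)) *\<^sub>R f y)"
        unfolding damped_kernel by (simp add: vec_eq_iff) (simp add: scaleR_conv_of_real)
    qed
    also have "c\<^sup>2 *\<^sub>R \<dots> = (1 / e) ^ 3 *\<^sub>R (LINT y|lborel. gaussian ((1 / e) *\<^sub>R (y - x)) *\<^sub>R f y)"
      using c by (simp only: integral_scaleR_right) simp
    also have "(LINT y|lborel. gaussian ((1 / e) *\<^sub>R (y - x)) *\<^sub>R f y) =
        e ^ 3 *\<^sub>R (LINT z|lborel. gaussian z *\<^sub>R f (x + e *\<^sub>R z))"
      using e by (subst lborel_integral_affine[of _ e x]) auto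
    also have "(1 / e) ^ 3 *\<^sub>R (e ^ 3 *\<^sub>R (LINT z|lborel. gaussian z *\<^sub>R f (x + e *\<^sub>R z))) =
        (LINT z|lborel. gaussian z *\<^sub>R f (x + e *\<^sub>R z))"
      using e by (simp add: power_divide)
    finally show ?thesis .
  qed
  have "(norm (fourier_integral f p))\<^sup>2 * exp (- (norm (e *\<^sub>R p))\<^sup>2 / 2) = fourier_integral f p \<bullet> g p" for p
    by (simp add: g_def w_def power2_norm_eq_inner)
  then show "(LINT p|lborel. (norm (fourier_integral f p))\<^sup>2 * exp (- (norm (e *\<^sub>R p))\<^sup>2 / 2)) =
      (LINT x|lborel. f x \<bullet> (LINT z|lborel. gaussian z *\<^sub>R f (x + e *\<^sub>R z)))"
    using fourier_integral_adjoint[OF f ig] by (simp add: conv)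
qed

lemma norm_axis_one [simp]: "norm (axis i 1 :: complex^'n) = 1"
  by (simp add: norm_eq_sqrt_inner inner_axis_axis)

lemma bounded_compact_support:
  fixes f :: spinor_field
  assumes [measurable]: "f \<in> borel_measurable borel"
    and M: "\<And>x. norm (f x) \<le> M" and supp: "\<And>x. x \<notin> cball 0 R \<Longrightarrow> f x = 0"
  shows "f \<in> L2_fields" "integrable lborel f"
proof -
  have i: "integrable lborel (\<lambda>x. indicator (cball (0::real^3) R) x *\<^sub>R B)" for B :: real
    by (intro integrable_scaleR_left integrable_real_indicator emeasure_bounded_finite) simp_all
  show "integrable lborel f"
    by (rule Bochner_Integration.integrable_bound[OF i[of M]])
       (use M supp in \<open>auto split: split_indicator intro!: order_trans[OF M abs_ge_self]\<close>)
  have "integrable lborel (\<lambda>x. (norm (f x))\<^sup>2)"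
    by (rule Bochner_Integration.integrable_bound[OF i[of "M\<^sup>2"]])
       (use supp in \<open>auto split: split_indicator intro!: power_mono M\<close>)
  then show "f \<in> L2_fields" by (simp add: L2_fields_def)
qed

lemma continuous_compact_support_bounded:
  fixes f :: spinor_field
  assumes f: "continuous_on UNIV f" and supp: "\<And>x. x \<notin> cball 0 R \<Longrightarrow> f x = 0"
  obtains M where "M \<ge> 0" "\<And>x. norm (f x) \<le> M"
proof -
  have "compact (f ` cball 0 R)"
    by (rule compact_continuous_image) (use f continuous_on_subset in auto)
  then obtain B where B: "\<And>x. x \<in> cball 0 R \<Longrightarrow> norm (f x) \<le> B"
    using compact_imp_bounded bounded_iff by (metis imageI)
  have "norm (f x) \<le> max B 0" for x
    using B[of x] supp[of x] by (cases "x \<in> cball 0 R") auto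
  then show ?thesis by (intro that[of "max B 0"]) auto
qed

text \<open>Let the width in the damped identity tend to 0. In position space continuity lets the
  Gaussian averages converge to \<open>f\<close>, with dominated convergence in the outer integral.
  In momentum space the weights increase to 1, so monotone convergence yields both
  square-integrability and the value.\<close>

lemma fourier_integral_isometry_continuous:
  assumes cont: "continuous_on UNIV f" and supp: "\<And>x. x \<notin> cball 0 R \<Longrightarrow> f x = 0"
  shows "fourier_integral f \<in> L2_fields" "L2_norm (fourier_integral f) = L2_norm f"
proof -
  obtain M where M0: "M \<ge> 0" and M: "\<And>x. norm (f x) \<le> M"
    using continuous_compact_support_bounded[OF cont supp] by metis
  have fm[measurable]: "f \<in> borel_measurable borel" using borel_measurable_continuous_onI[OF cont] .
  have f: "f \<in> L2_fields" and int: "integrable lborel f"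
    by (rule bounded_compact_support[OF fm M supp], assumption)+
  define e :: "nat \<Rightarrow> real" where "e n = 1 / real (Suc n)" for n
  have e: "e n > 0" for n by (simp add: e_def)
  have e0: "e \<longlonglongrightarrow> 0" unfolding e_def by (rule LIMSEQ_Suc[OF lim_1_over_n])
  define G where "G n x = (LINT z|lborel. gaussian z *\<^sub>R f (x + e n *\<^sub>R z))" for n x
  have [measurable]: "G n \<in> borel_measurable borel" for n unfolding G_def by measurable
  have bd: "norm (gaussian z *\<^sub>R f (x + e n *\<^sub>R z)) \<le> M * gaussian z" for n x z
    using mult_right_mono[OF M, of "gaussian z"] gaussian_pos[of z] by (simp add: mult.commute)
  have iM: "integrable lborel (\<lambda>z. M * gaussian z)" by (simp add: gaussian_integrable)
  have igf: "integrable lborel (\<lambda>z. gaussian z *\<^sub>R f (x + e n *\<^sub>R z))" for n x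
    by (rule Bochner_Integration.integrable_bound[OF iM])
       (simp, rule AE_I2, rule order_trans[OF bd], simp)
  have GM: "norm (G n x) \<le> M" for n x
  proof -
    have "norm (G n x) \<le> (LINT z|lborel. norm (gaussian z *\<^sub>R f (x + e n *\<^sub>R z)))"
      unfolding G_def by (rule integral_norm_bound)
    also have "\<dots> \<le> (LINT z|lborel. M * gaussian z)"
      by (intro integral_mono integrable_norm igf iM bd)
    finally show ?thesis by (simp add: gaussian_integral)
  qed
  have Glim: "(\<lambda>n. G n x) \<longlonglongrightarrow> f x" for x
  proof -
    have "(\<lambda>n. G n x) \<longlonglongrightarrow> (LINT z|lborel. gaussian z *\<^sub>R f x)"
      unfolding G_def
    proof (rule integral_dominated_convergence[OF _ _ iM])
      have "(\<lambda>n. f (x + e n *\<^sub>R z)) \<longlonglongrightarrow> f x" for z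
      proof (rule continuous_on_tendsto_compose[OF cont])
        show "(\<lambda>n. x + e n *\<^sub>R z) \<longlonglongrightarrow> x" using e0 by (auto intro!: tendsto_eq_intros)
      qed auto
      then show "AE z in lborel. (\<lambda>n. gaussian z *\<^sub>R f (x + e n *\<^sub>R z)) \<longlonglongrightarrow> gaussian z *\<^sub>R f x"
        by (auto intro!: tendsto_intros)
    qed (use bd in auto)
    then show ?thesis by (simp add: gaussian_integrable gaussian_integral)
  qed
  have "(\<lambda>n. LINT x|lborel. f x \<bullet> G n x) \<longlonglongrightarrow> (LINT x|lborel. f x \<bullet> f x)"
  proof (rule integral_dominated_convergence)
    show "integrable lborel (\<lambda>x. norm (f x) * M)" using int by simp
    show "AE x in lborel. (\<lambda>n. f x \<bullet> G n x) \<longlonglongrightarrow> f x \<bullet> f x"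
      by (auto intro!: tendsto_intros Glim)
    show "AE x in lborel. norm (f x \<bullet> G n x) \<le> norm (f x) * M" for n
      using order_trans[OF Cauchy_Schwarz_ineq2 mult_left_mono[OF GM norm_ge_zero]] by simp
  qed auto
  then have lim: "(\<lambda>n. LINT p|lborel. (norm (fourier_integral f p))\<^sup>2 * exp (- (norm (e n *\<^sub>R p))\<^sup>2 / 2))
      \<longlonglongrightarrow> (LINT x|lborel. (norm (f x))\<^sup>2)"
    unfolding fourier_integral_gaussian_damped(1)[OF int e] G_def by (simp add: power2_norm_eq_inner)
  have mono: "mono (\<lambda>n. (norm (fourier_integral f p))\<^sup>2 * exp (- (norm (e n *\<^sub>R p))\<^sup>2 / 2))" for p
  proof (intro monoI mult_left_mono)
    fix m n :: nat assume "m \<le> n"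
    then have "e n \<le> e m" by (simp add: e_def frac_le)
    then have "norm (e n *\<^sub>R p) \<le> norm (e m *\<^sub>R p)"
      using e[of n] e[of m] by (simp add: mult_right_mono)
    then show "exp (- (norm (e m *\<^sub>R p))\<^sup>2 / 2) \<le> exp (- (norm (e n *\<^sub>R p))\<^sup>2 / 2)"
      using power_mono[of "norm (e n *\<^sub>R p)" "norm (e m *\<^sub>R p)" 2] by simp
  qed simp
  have plim: "(\<lambda>n. (norm (fourier_integral f p))\<^sup>2 * exp (- (norm (e n *\<^sub>R p))\<^sup>2 / 2))
      \<longlonglongrightarrow> (norm (fourier_integral f p))\<^sup>2" for p
  proof -
    have "(\<lambda>n. (norm (fourier_integral f p))\<^sup>2 * exp (- (norm (e n *\<^sub>R p))\<^sup>2 / 2))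
        \<longlonglongrightarrow> (norm (fourier_integral f p))\<^sup>2 * exp (- (norm (0 *\<^sub>R p))\<^sup>2 / 2)"
      by (intro tendsto_intros e0) simp
    then show ?thesis by simp
  qed
  have mc: "integrable lborel (\<lambda>p. (norm (fourier_integral f p))\<^sup>2)"
    "(LINT p|lborel. (norm (fourier_integral f p))\<^sup>2) = (LINT x|lborel. (norm (f x))\<^sup>2)"
    using integrable_monotone_convergence[OF fourier_integral_gaussian_damped(2)[OF int e] _ _ lim, of "\<lambda>p. (norm (fourier_integral f p))\<^sup>2"]
      integral_monotone_convergence[OF fourier_integral_gaussian_damped(2)[OF int e] _ _ lim, of "\<lambda>p. (norm (fourier_integral f p))\<^sup>2"]
      mono plim by auto
  then show "fourier_integral f \<in> L2_fields" "L2_norm (fourier_integral f) = L2_norm f"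
    by (simp_all add: L2_fields_def L2_norm_def)
qed

section \<open>From continuous to arbitrary fields of compact support\<close>

definition clamp_norm :: "real \<Rightarrow> 'a::real_normed_vector \<Rightarrow> 'a" where
  "clamp_norm K v = (1 / max 1 (norm v / K)) *\<^sub>R v"

lemma clamp_norm_eq: "K > 0 \<Longrightarrow> norm v \<le> K \<Longrightarrow> clamp_norm K v = v"
  by (simp add: clamp_norm_def max_def)

lemma norm_clamp_norm_le:
  assumes "K > 0"
  shows "norm (clamp_norm K v) \<le> K" "norm (clamp_norm K v) \<le> norm v"
proof -
  have m: "max 1 (norm v / K) > 0" "norm v \<le> K * max 1 (norm v / K)" "norm v * 1 \<le> norm v * max 1 (norm v / K)"
    using assms by (auto simp: max_def field_simps intro: mult_right_mono)
  then show "norm (clamp_norm K v) \<le> K" "norm (clamp_norm K v) \<le> norm v"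
    by (simp_all add: clamp_norm_def pos_divide_le_eq)
qed

lemma continuous_on_clamp_norm: "K > 0 \<Longrightarrow> continuous_on UNIV (clamp_norm K)"
  unfolding clamp_norm_def by (intro continuous_intros) auto

text \<open>A measurable field is an almost everywhere limit of continuous ones, but without a
  common majorant. The radial retraction \<open>clamp_norm\<close> bounds the approximants and a
  continuous cutoff confines them to a ball; both are continuous and, applied to the limit, change
  \<open>f\<close> only where its norm is large.\<close>

lemma L2_approx_continuous:
  assumes f: "f \<in> L2_fields" and supp: "\<And>x. x \<notin> cball 0 R \<Longrightarrow> f x = 0" and e: "e > 0"
  shows "\<exists>g. continuous_on UNIV g \<and> (\<forall>x. x \<notin> cball 0 (R + 1) \<longrightarrow> g x = 0) \<and>
    L2_norm (\<lambda>x. g x - f x) < e"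
proof -
  note [measurable] = L2_fields_measurable[OF f]
  let ?f = "\<lambda>n x. clamp_norm (real (Suc n)) (f x)"
  have fm: "?f n \<in> borel_measurable borel" for n
    using measurable_compose[OF L2_fields_measurable[OF f] borel_measurable_continuous_onI[OF continuous_on_clamp_norm]]
    by simp
  have "(\<lambda>n. L2_norm (\<lambda>x. ?f n x - f x)) \<longlonglongrightarrow> 0"
  proof (rule L2_dominated_convergence[OF f])
    have "(\<lambda>n. ?f n x) \<longlonglongrightarrow> f x" for x
    proof (rule tendsto_eventually)
      obtain N where "norm (f x) \<le> real N" using real_arch_simple by blast
      then have "\<forall>n\<ge>N. ?f n x = f x" by (intro allI impI clamp_norm_eq) auto
      then show "\<forall>\<^sub>F n in sequentially. ?f n x = f x" unfolding eventually_sequentially by blast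
    qed
    then show "AE x in lborel. (\<lambda>n. ?f n x) \<longlonglongrightarrow> f x" by simp
    show "AE x in lborel. norm (?f n x) \<le> norm (f x)" for n
      by (simp add: norm_clamp_norm_le)
  qed (use fm in auto)
  from LIMSEQ_D[OF this, of "e/2"] e obtain n where "L2_norm (\<lambda>x. ?f n x - f x) < e / 2" by auto
  then obtain K where K: "K > 0" and Kf: "L2_norm (\<lambda>x. clamp_norm K (f x) - f x) < e / 2"
    by (metis of_nat_0_less_iff zero_less_Suc)
  have clamp_m: "(\<lambda>x. clamp_norm K (u x)) \<in> borel_measurable borel" if "u \<in> borel_measurable borel" for u :: spinor_field
    using measurable_compose[OF that borel_measurable_continuous_onI[OF continuous_on_clamp_norm[OF K]]] .
  have "f measurable_on UNIV"
    by (rule lebesgue_measurable_imp_measurable_on) (auto intro: measurable_completion)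
  then obtain N h where N: "negligible N" and h: "\<And>n. continuous_on UNIV (h n)"
    and lim: "\<And>x. x \<notin> N \<Longrightarrow> (\<lambda>n. h n x) \<longlonglongrightarrow> f x"
    unfolding measurable_on_def by auto
  have AE_N: "AE x in lborel. x \<notin> N"
  proof -
    have "AE x in lebesgue. x \<notin> N" using N by (simp add: negligible_iff_null_sets AE_not_in)
    then show ?thesis by (simp add: AE_completion_iff)
  qed
  \<comment> \<open>The cutoff descends linearly from 1 to 0 in a collar of width 1, which is the
    reason for the radius \<open>R + 1\<close>.\<close>
  define cut :: "real^3 \<Rightarrow> real" where "cut x = max 0 (min 1 (R + 1 - norm x))" for x
  have cut: "0 \<le> cut x" "cut x \<le> 1" "x \<in> cball 0 R \<Longrightarrow> cut x = 1" "x \<notin> cball 0 (R + 1) \<Longrightarrow> cut x = 0" for x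
    by (auto simp: cut_def)
  define g where "g n x = cut x *\<^sub>R clamp_norm K (h n x)" for n x
  have gc: "continuous_on UNIV (g n)" for n
  proof -
    have "continuous_on UNIV (\<lambda>x. clamp_norm K (h n x))"
      by (rule continuous_on_compose2[OF continuous_on_clamp_norm[OF K] h]) simp
    then show ?thesis unfolding g_def cut_def by (intro continuous_intros)
  qed
  have gs: "g n x = 0" if "x \<notin> cball 0 (R + 1)" for n x using cut(4)[OF that] by (simp add: g_def)
  \<comment> \<open>Dominated convergence is stated with a spinor field as majorant, so the constant
    \<open>K\<close> on the ball is carried by a unit vector.\<close>
  let ?d = "\<lambda>x::real^3. indicator (cball 0 (R + 1)) x *\<^sub>R (K *\<^sub>R (axis 1 1 :: complex^4))"
  have [measurable]: "cball (0::real^3) (R + 1) \<in> sets borel" by simp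
  have d: "?d \<in> L2_fields"
  proof (rule bounded_compact_support(1)[of _ K "R + 1"])
    show "?d \<in> borel_measurable borel" by measurable
  qed (use K in \<open>auto split: split_indicator\<close>)
  have "(\<lambda>n. L2_norm (\<lambda>x. g n x - clamp_norm K (f x))) \<longlonglongrightarrow> 0"
  proof (rule L2_dominated_convergence[OF d])
    show "g n \<in> borel_measurable borel" for n using borel_measurable_continuous_onI[OF gc] .
    show "(\<lambda>x. clamp_norm K (f x)) \<in> borel_measurable borel" by (rule clamp_m) simp
    show "AE x in lborel. (\<lambda>n. g n x) \<longlonglongrightarrow> clamp_norm K (f x)"
      using AE_N
    proof eventually_elim
      case (elim x)
      have "(\<lambda>n. clamp_norm K (h n x)) \<longlonglongrightarrow> clamp_norm K (f x)"
        by (rule continuous_on_tendsto_compose[OF continuous_on_clamp_norm[OF K] lim[OF elim]]) auto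
      then have "(\<lambda>n. g n x) \<longlonglongrightarrow> cut x *\<^sub>R clamp_norm K (f x)"
        unfolding g_def by (intro tendsto_intros)
      also have "cut x *\<^sub>R clamp_norm K (f x) = clamp_norm K (f x)"
        using cut(3)[of x] supp[of x] by (cases "x \<in> cball 0 R") (auto simp: clamp_norm_def)
      finally show ?case .
    qed
    have "norm (g n x) \<le> norm (?d x)" for n x
    proof (cases "x \<in> cball 0 (R + 1)")
      case True
      have "norm (g n x) \<le> 1 * K"
        unfolding g_def norm_scaleR
        by (intro mult_mono) (use cut[of x] norm_clamp_norm_le[OF K] in auto)
      then show ?thesis using True K by simp
    qed (simp add: gs)
    then show "AE x in lborel. norm (g n x) \<le> norm (?d x)" for n by simp
  qed
  from LIMSEQ_D[OF this, of "e/2"] e obtain n where n: "L2_norm (\<lambda>x. g n x - clamp_norm K (f x)) < e / 2" by auto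
  obtain M where M: "\<And>x. norm (g n x) \<le> M"
    using continuous_compact_support_bounded[OF gc gs] by metis
  have gL: "g n \<in> L2_fields"
    using bounded_compact_support(1)[OF borel_measurable_continuous_onI[OF gc] M gs] .
  have cL: "(\<lambda>x. clamp_norm K (f x)) \<in> L2_fields"
    by (rule L2_dominated(1)[OF f clamp_m, where C = 1]) (use norm_clamp_norm_le(2)[OF K] in auto)
  from L2_norm_triangle_diff[OF gL cL f] n Kf have "L2_norm (\<lambda>x. g n x - f x) < e" by simp
  with gc gs show ?thesis by blast
qed

lemma L2_compact_support_integrable:
  assumes h: "h \<in> L2_fields" and supp: "\<And>x. x \<notin> cball 0 S \<Longrightarrow> h x = 0"
  shows "integrable lborel h"
    and "(LINT x|lborel. norm (h x)) \<le> L2_norm h * sqrt (measure lborel (cball (0::real^3) S))"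
proof -
  note [measurable] = L2_fields_measurable[OF h]
  \<comment> \<open>Cauchy-Schwarz is applied to \<open>norm (h x)\<close> and to the indicator of
    the ball; a fixed unit vector turns these scalar functions into fields.\<close>
  define u :: "complex^4" where "u = axis 1 1"
  have u: "norm u = 1" "u \<bullet> u = 1" by (simp_all add: u_def inner_axis_axis)
  define a where "a x = norm (h x) *\<^sub>R u" for x
  define b :: spinor_field where "b x = indicator (cball 0 S) x *\<^sub>R u" for x
  have na: "norm (a x) = norm (h x)" and nb: "norm (b x) = indicator (cball 0 S) x"
    and ab: "a x \<bullet> b x = norm (h x)" for x
    using supp[of x] by (auto simp: a_def b_def u split: split_indicator)
  have a: "a \<in> L2_fields"
  proof -
    have "a \<in> borel_measurable borel" unfolding a_def by measurable
    then show ?thesis using L2_fields_integrable[OF h] by (simp add: L2_fields_def na)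
  qed
  have [measurable]: "cball (0::real^3) S \<in> sets borel" by simp
  have b: "b \<in> L2_fields"
  proof (rule bounded_compact_support(1)[of _ 1 S])
    show "b \<in> borel_measurable borel" unfolding b_def by measurable
  qed (auto simp: b_def u split: split_indicator)
  have i: "integrable lborel (\<lambda>x. norm (h x))"
    using L2_inner_integrable[OF a b] by (simp add: ab)
  then show "integrable lborel h" by (subst (asm) integrable_norm_iff) auto
  have "L2_norm a = L2_norm h" by (simp add: L2_norm_def na)
  moreover have "L2_norm b = sqrt (measure lborel (cball (0::real^3) S))"
  proof -
    have "(norm (b x))\<^sup>2 = indicator (cball 0 S) x" for x by (simp add: nb split: split_indicator)
    then show ?thesis by (simp add: L2_norm_def)
  qed
  ultimately show "(LINT x|lborel. norm (h x)) \<le> L2_norm h * sqrt (measure lborel (cball (0::real^3) S))"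
    using L2_Cauchy_Schwarz[OF a b] by (simp add: ab)
qed

text \<open>For continuous approximants, the isometry on differences makes the transforms Cauchy in
  the norm. The common compact support bounds the integral of a difference by its
  \<open>L2_norm\<close>, so the transforms also converge at every point, and this identifies their
  limit.\<close>

theorem fourier_integral_isometry:
  assumes f: "f \<in> L2_fields" and supp: "\<And>x. x \<notin> cball 0 R \<Longrightarrow> f x = 0"
  shows "fourier_integral f \<in> L2_fields" "L2_norm (fourier_integral f) = L2_norm f"
proof -
  have "\<exists>g. continuous_on UNIV g \<and> (\<forall>x. x \<notin> cball 0 (R + 1) \<longrightarrow> g x = 0) \<and>
      L2_norm (\<lambda>x. g x - f x) < 1 / real (Suc n)" for n
    by (rule L2_approx_continuous[OF f]) (use supp in auto)
  then obtain g where cont: "\<And>n. continuous_on UNIV (g n)"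
    and gs: "\<And>n x. x \<notin> cball 0 (R + 1) \<Longrightarrow> g n x = 0"
    and gf: "\<And>n. L2_norm (\<lambda>x. g n x - f x) < 1 / real (Suc n)" by metis
  have gL: "g n \<in> L2_fields" for n
  proof -
    obtain M where M: "\<And>x. norm (g n x) \<le> M"
      using continuous_compact_support_bounded[OF cont gs] by metis
    show ?thesis
      using bounded_compact_support(1)[OF borel_measurable_continuous_onI[OF cont] M gs] .
  qed
  have fs: "f x = 0" if "x \<notin> cball 0 (R + 1)" for x using that by (intro supp) auto
  have lim: "(\<lambda>n. L2_norm (\<lambda>x. g n x - f x)) \<longlonglongrightarrow> 0"
    by (rule tendsto_sandwich[OF _ _ tendsto_const LIMSEQ_Suc[OF lim_1_over_n]])
       (simp, intro always_eventually allI less_imp_le gf)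
  have int: "integrable lborel (g n)" for n
    by (rule L2_compact_support_integrable(1)[OF gL gs])
  have intf: "integrable lborel f"
    by (rule L2_compact_support_integrable(1)[OF f fs])
  have Fg: "fourier_integral (g n) \<in> L2_fields" for n
    using fourier_integral_isometry_continuous(1)[OF cont gs] .
  have isod: "L2_norm (\<lambda>p. fourier_integral (g m) p - fourier_integral (g n) p) = L2_norm (\<lambda>x. g m x - g n x)" for m n
  proof -
    have "fourier_integral (\<lambda>x. g m x - g n x) = (\<lambda>p. fourier_integral (g m) p - fourier_integral (g n) p)"
      using fourier_integral_diff[OF int int] by auto
    moreover have "L2_norm (fourier_integral (\<lambda>x. g m x - g n x)) = L2_norm (\<lambda>x. g m x - g n x)"
      by (rule fourier_integral_isometry_continuous(2)[of _ "R + 1"]) (use gs in \<open>auto intro!: continuous_intros cont\<close>)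
    ultimately show ?thesis by simp
  qed
  have C: "\<exists>N. \<forall>m\<ge>N. \<forall>n\<ge>N. L2_norm (\<lambda>p. fourier_integral (g m) p - fourier_integral (g n) p) \<le> e"
    if e: "e > 0" for e
  proof -
    obtain N where N: "\<forall>n\<ge>N. norm (L2_norm (\<lambda>x. g n x - f x) - 0) < e / 2"
      using LIMSEQ_D[OF lim, of "e/2"] e by auto
    have "L2_norm (\<lambda>x. g m x - g n x) \<le> e" if "m \<ge> N" "n \<ge> N" for m n
    proof -
      have "L2_norm (\<lambda>x. g m x - f x) < e / 2" "L2_norm (\<lambda>x. g n x - f x) < e / 2"
        using N that by simp_all
      then show ?thesis
        using L2_norm_triangle_diff[OF gL[of m] f gL[of n]] L2_norm_minus_commute[of f "g n"] by linarith
    qed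
    then show ?thesis unfolding isod by blast
  qed
  have ptw: "(\<lambda>n. fourier_integral (g n) p) \<longlonglongrightarrow> fourier_integral f p" for p
  proof (rule Lim_null[THEN iffD2], rule Lim_null_comparison)
    let ?V = "(2 * pi) powr (-3/2) * sqrt (measure lborel (cball (0::real^3) (R + 1)))"
    have "norm (fourier_integral (g n) p - fourier_integral f p) \<le> ?V * L2_norm (\<lambda>x. g n x - f x)" for n
    proof -
      have "norm (fourier_integral (\<lambda>x. g n x - f x) p) \<le>
          (2 * pi) powr (-3/2) * (LINT x|lborel. norm (g n x - f x))"
        by (rule norm_fourier_integral_le)
      also have "\<dots> \<le> (2 * pi) powr (-3/2) * (L2_norm (\<lambda>x. g n x - f x) * sqrt (measure lborel (cball (0::real^3) (R + 1))))"
        by (intro mult_left_mono L2_compact_support_integrable(2) L2_fields_diff gL f) (auto simp: gs fs)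
      finally show ?thesis by (simp add: fourier_integral_diff[OF int intf] mult_ac)
    qed
    then show "\<forall>\<^sub>F n in sequentially. norm (fourier_integral (g n) p - fourier_integral f p) \<le> ?V * L2_norm (\<lambda>x. g n x - f x)"
      by simp
    show "(\<lambda>n. ?V * L2_norm (\<lambda>x. g n x - f x)) \<longlonglongrightarrow> 0"
      using tendsto_mult_left[OF lim, of ?V] by simp
  qed
  have mF: "fourier_integral f \<in> borel_measurable borel"
    using L2_fields_measurable[OF f] by simp
  from L2_Cauchy_pointwise_limit[OF Fg mF _ C] ptw
  have FL: "fourier_integral f \<in> L2_fields"
    and Flim: "(\<lambda>n. L2_norm (\<lambda>x. fourier_integral (g n) x - fourier_integral f x)) \<longlonglongrightarrow> 0" by auto
  show "fourier_integral f \<in> L2_fields" by (rule FL)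
  have "(\<lambda>n. L2_norm (fourier_integral (g n))) \<longlonglongrightarrow> L2_norm (fourier_integral f)"
    by (rule L2_norm_tendsto[OF Fg FL Flim])
  moreover have "(\<lambda>n. L2_norm (fourier_integral (g n))) \<longlonglongrightarrow> L2_norm f"
    using L2_norm_tendsto[OF gL f lim] fourier_integral_isometry_continuous(2)[OF cont gs] by simp
  ultimately show "L2_norm (fourier_integral f) = L2_norm f" by (rule LIMSEQ_unique)
qed

section \<open>The Fourier transform as a unitary map\<close>

lemma L2_norm_affine:
  assumes f: "f \<in> L2_fields" and c: "\<bar>c\<bar> = 1"
  shows "(\<lambda>x. f (t + c *\<^sub>R x)) \<in> L2_fields" "L2_norm (\<lambda>x. f (t + c *\<^sub>R x)) = L2_norm f"
proof -
  note [measurable] = L2_fields_measurable[OF f]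
  have m: "(\<lambda>x. (norm (f x))\<^sup>2) \<in> borel_measurable borel" and c0: "c \<noteq> 0" using c by auto
  have "(\<lambda>x. f (t + c *\<^sub>R x)) \<in> borel_measurable borel" by measurable
  then show "(\<lambda>x. f (t + c *\<^sub>R x)) \<in> L2_fields"
    using lborel_integrable_affine[OF m c0, of t] L2_fields_integrable[OF f] by (simp add: L2_fields_def)
  show "L2_norm (\<lambda>x. f (t + c *\<^sub>R x)) = L2_norm f"
    using lborel_integral_affine[OF m c0, of t] c by (simp add: L2_norm_def)
qed

lemma L2_translate:
  assumes "f \<in> L2_fields"
  shows "(\<lambda>x. f (x + a)) \<in> L2_fields" "L2_norm (\<lambda>x. f (x + a)) = L2_norm f"
  using L2_norm_affine[OF assms, of 1 a] by (simp_all add: add.commute)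

lemma L2_reflect:
  assumes "f \<in> L2_fields"
  shows "(\<lambda>x. f (- x)) \<in> L2_fields" "L2_norm (\<lambda>x. f (- x)) = L2_norm f"
  using L2_norm_affine[OF assms, of "-1" 0] by simp_all

lemma AE_lborel_translate:
  fixes a :: "'a::euclidean_space"
  assumes "AE x in lborel. P x"
  shows "AE x in lborel. P (x + a)"
proof -
  have "AE x in distr lborel borel ((+) a). P x" by (subst lborel_distr_plus) (rule assms)
  from AE_distrD[OF _ this] show ?thesis by (simp add: add.commute)
qed

lemma L2_restrict_ball_tendsto:
  assumes f: "f \<in> L2_fields"
  shows "((\<lambda>R. L2_norm (\<lambda>x. indicator (cball 0 R) x *\<^sub>R f x - f x)) \<longlongrightarrow> 0) at_top"
proof (rule tendsto_at_topI_sequentially)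
  fix X :: "nat \<Rightarrow> real" assume X: "filterlim X at_top sequentially"
  note [measurable] = L2_fields_measurable[OF f]
  show "(\<lambda>n. L2_norm (\<lambda>x. indicator (cball 0 (X n)) x *\<^sub>R f x - f x)) \<longlonglongrightarrow> 0"
  proof (rule L2_dominated_convergence[OF f])
    show "(\<lambda>x. indicator (cball 0 (X n)) x *\<^sub>R f x) \<in> borel_measurable borel" for n
      by (rule L2_fields_measurable[OF L2_indicator(1)[OF f]]) simp
    have "(\<lambda>n. indicator (cball 0 (X n)) x *\<^sub>R f x) \<longlonglongrightarrow> f x" for x
    proof (rule tendsto_eventually)
      have "\<forall>\<^sub>F n in sequentially. norm x \<le> X n"
        using X by (simp add: filterlim_at_top)
      then show "\<forall>\<^sub>F n in sequentially. indicator (cball 0 (X n)) x *\<^sub>R f x = f x"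
        by eventually_elim simp
    qed
    then show "AE x in lborel. (\<lambda>n. indicator (cball 0 (X n)) x *\<^sub>R f x) \<longlonglongrightarrow> f x" by simp
    show "AE x in lborel. norm (indicator (cball 0 (X n)) x *\<^sub>R f x) \<le> norm (f x)" for n
      by (intro AE_I2) (simp split: split_indicator)
  qed simp
qed

lemma integrable_restrict_ball:
  assumes "f \<in> L2_fields"
  shows "integrable lborel (\<lambda>x. indicator (cball 0 R) x *\<^sub>R f x)"
  by (rule L2_compact_support_integrable(1)[OF L2_indicator(1)[OF assms], of _ R]) auto

lemma fourier_truncated_L2:
  assumes f: "f \<in> L2_fields"
  shows "fourier_truncated R f \<in> L2_fields"
    "L2_norm (fourier_truncated R f) = L2_norm (\<lambda>x. indicator (cball 0 R) x *\<^sub>R f x)"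
  unfolding fourier_truncated_eq
  by (rule fourier_integral_isometry[OF L2_indicator(1)[OF f], of _ R]; simp)+

text \<open>Linearity and the isometry on the ball of radius \<open>max R S\<close>. With
  \<open>f = g\<close> it transfers the Cauchy property from the truncated fields to their
  transforms.\<close>

lemma L2_norm_fourier_truncated_diff:
  assumes f: "f \<in> L2_fields" and g: "g \<in> L2_fields"
  shows "L2_norm (\<lambda>p. fourier_truncated R f p - fourier_truncated S g p) =
    L2_norm (\<lambda>x. indicator (cball 0 R) x *\<^sub>R f x - indicator (cball 0 S) x *\<^sub>R g x)"
proof -
  have "(\<lambda>p. fourier_truncated R f p - fourier_truncated S g p) =
      fourier_integral (\<lambda>x. indicator (cball 0 R) x *\<^sub>R f x - indicator (cball 0 S) x *\<^sub>R g x)"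
    by (simp add: fourier_truncated_eq fun_eq_iff
        fourier_integral_diff[OF integrable_restrict_ball[OF f] integrable_restrict_ball[OF g]])
  moreover have "L2_norm \<dots> = L2_norm (\<lambda>x. indicator (cball 0 R) x *\<^sub>R f x - indicator (cball 0 S) x *\<^sub>R g x)"
    by (rule fourier_integral_isometry(2)[OF L2_fields_diff[OF L2_indicator(1)[OF f] L2_indicator(1)[OF g]], of _ _ "max R S"])
       auto
  ultimately show ?thesis by simp
qed

text \<open>Completeness provides the limit in the mean, so that the choice operator in
  \<open>fourier\<close> has a witness.\<close>

theorem fourier_tendsto:
  assumes f: "f \<in> L2_fields"
  shows "L2_tendsto (\<lambda>R. fourier_truncated R f) (fourier f) at_top"
proof -
  let ?T = "\<lambda>R. fourier_truncated R f" and ?c = "\<lambda>R x. indicator (cball 0 R) x *\<^sub>R f x"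
  have TL: "?T R \<in> L2_fields" and cL: "?c R \<in> L2_fields" for R
    using fourier_truncated_L2(1)[OF f] L2_indicator(1)[OF f] by simp_all
  have seq: "(\<lambda>n. L2_norm (\<lambda>x. ?c (real n) x - f x)) \<longlonglongrightarrow> 0"
    by (rule filterlim_compose[OF L2_restrict_ball_tendsto[OF f] filterlim_real_sequentially])
  have "\<exists>g\<in>L2_fields. (\<lambda>n. L2_norm (\<lambda>x. ?T (real n) x - g x)) \<longlonglongrightarrow> 0"
  proof (rule L2_complete[OF TL])
    fix e :: real assume e: "e > 0"
    obtain N where N: "\<forall>n\<ge>N. norm (L2_norm (\<lambda>x. ?c (real n) x - f x) - 0) < e / 2"
      using LIMSEQ_D[OF seq, of "e / 2"] e by auto
    have "L2_norm (\<lambda>x. ?T (real m) x - ?T (real n) x) \<le> e" if "m \<ge> N" "n \<ge> N" for m n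
    proof -
      have "L2_norm (\<lambda>x. ?c (real m) x - f x) < e / 2" "L2_norm (\<lambda>x. ?c (real n) x - f x) < e / 2"
        using N that by simp_all
      then show ?thesis
        using L2_norm_triangle_diff[OF cL[of "real m"] f cL[of "real n"]]
          L2_norm_minus_commute[of f "?c (real n)"] L2_norm_fourier_truncated_diff[OF f f, of "real m" "real n"]
        by linarith
    qed
    then show "\<exists>N. \<forall>m\<ge>N. \<forall>n\<ge>N. L2_norm (\<lambda>x. ?T (real m) x - ?T (real n) x) \<le> e" by blast
  qed
  then obtain g where g: "g \<in> L2_fields" and lim: "(\<lambda>n. L2_norm (\<lambda>x. ?T (real n) x - g x)) \<longlonglongrightarrow> 0" by blast
  \<comment> \<open>The limit \<open>g\<close> was obtained along integer radii only. Sending the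
    second radius of the isometry to infinity gives this equality for every real \<open>R\<close>,
    hence convergence along \<open>at_top\<close>.\<close>
  have eq: "L2_norm (\<lambda>x. ?T R x - g x) = L2_norm (\<lambda>x. ?c R x - f x)" for R
  proof -
    have "(\<lambda>n. L2_norm (\<lambda>x. ?T R x - ?T (real n) x)) \<longlonglongrightarrow> L2_norm (\<lambda>x. ?T R x - g x)"
      by (rule L2_norm_tendsto[OF L2_fields_diff[OF TL TL] L2_fields_diff[OF TL g]])
         (use lim in \<open>simp add: L2_norm_minus_commute[of g]\<close>)
    moreover have "(\<lambda>n. L2_norm (\<lambda>x. ?c R x - ?c (real n) x)) \<longlonglongrightarrow> L2_norm (\<lambda>x. ?c R x - f x)"
      by (rule L2_norm_tendsto[OF L2_fields_diff[OF cL cL] L2_fields_diff[OF cL f]])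
         (use seq in \<open>simp add: L2_norm_minus_commute[of f]\<close>)
    ultimately show ?thesis
      by (simp add: L2_norm_fourier_truncated_diff[OF f f] LIMSEQ_unique)
  qed
  have "L2_tendsto ?T g at_top"
    unfolding L2_tendsto_def eq using TL g L2_restrict_ball_tendsto[OF f] by blast
  then show ?thesis unfolding fourier_def by (rule someI[where P = "\<lambda>g. L2_tendsto ?T g at_top"])
qed

lemma fourier_L2: "f \<in> L2_fields \<Longrightarrow> fourier f \<in> L2_fields"
  using fourier_tendsto by (simp add: L2_tendsto_def)

lemma fourier_limit:
  "f \<in> L2_fields \<Longrightarrow> ((\<lambda>R. L2_norm (\<lambda>p. fourier_truncated R f p - fourier f p)) \<longlongrightarrow> 0) at_top"
  using fourier_tendsto by (simp add: L2_tendsto_def)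

lemma fourier_eq_AE:
  assumes f: "f \<in> L2_fields" and g: "g \<in> L2_fields"
    and lim: "((\<lambda>R. L2_norm (\<lambda>p. fourier_truncated R f p - g p)) \<longlongrightarrow> 0) at_top"
  shows "AE p in lborel. fourier f p = g p"
  by (rule L2_limit_unique[OF fourier_truncated_L2(1)[OF f] fourier_L2[OF f] g _ fourier_limit[OF f] lim]) simp

theorem fourier_isometry:
  assumes f: "f \<in> L2_fields"
  shows "L2_norm (fourier f) = L2_norm f"
proof (rule tendsto_unique)
  show "((\<lambda>R. L2_norm (fourier_truncated R f)) \<longlongrightarrow> L2_norm (fourier f)) at_top"
    by (rule L2_norm_tendsto[OF fourier_truncated_L2(1)[OF f] fourier_L2[OF f] fourier_limit[OF f]])
  show "((\<lambda>R. L2_norm (fourier_truncated R f)) \<longlongrightarrow> L2_norm f) at_top"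
    unfolding fourier_truncated_L2(2)[OF f]
    by (rule L2_norm_tendsto[OF L2_indicator(1)[OF f] f L2_restrict_ball_tendsto[OF f]]) simp
qed simp

text \<open>Linearity survives only almost everywhere, since each \<open>fourier\<close> selects its
  own representative.\<close>

lemma fourier_diff:
  assumes f: "f \<in> L2_fields" and g: "g \<in> L2_fields"
  shows "AE p in lborel. fourier (\<lambda>x. f x - g x) p = fourier f p - fourier g p"
proof (rule fourier_eq_AE[OF L2_fields_diff[OF f g] L2_fields_diff[OF fourier_L2[OF f] fourier_L2[OF g]]])
  let ?T = fourier_truncated
  have T: "?T R (\<lambda>x. f x - g x) p = ?T R f p - ?T R g p" for R p
    using fourier_integral_diff[OF integrable_restrict_ball[OF f] integrable_restrict_ball[OF g]]
    by (simp add: fourier_truncated_eq scaleR_diff_right)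
  have "L2_norm (\<lambda>p. ?T R (\<lambda>x. f x - g x) p - (fourier f p - fourier g p)) \<le>
      L2_norm (\<lambda>p. ?T R f p - fourier f p) + L2_norm (\<lambda>p. ?T R g p - fourier g p)" for R
    using L2_norm_triangle[OF L2_fields_diff[OF fourier_truncated_L2(1)[OF f, of R] fourier_L2[OF f]]
        L2_fields_diff[OF fourier_L2[OF g] fourier_truncated_L2(1)[OF g, of R]]]
    by (simp add: T L2_norm_minus_commute[of "fourier g"] algebra_simps)
  then show "((\<lambda>R. L2_norm (\<lambda>p. ?T R (\<lambda>x. f x - g x) p - (fourier f p - fourier g p))) \<longlongrightarrow> 0) at_top"
    by (intro tendsto_sandwich[OF _ _ tendsto_const tendsto_add_zero[OF fourier_limit[OF f] fourier_limit[OF g]]]) simp_all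
qed

lemma L2_norm_fourier_diff:
  assumes f: "f \<in> L2_fields" and g: "g \<in> L2_fields"
  shows "L2_norm (\<lambda>p. fourier f p - fourier g p) = L2_norm (\<lambda>x. f x - g x)"
proof -
  have "L2_norm (\<lambda>p. fourier f p - fourier g p) = L2_norm (fourier (\<lambda>x. f x - g x))"
  proof (rule L2_norm_cong_AE)
    show "AE p in lborel. norm (fourier f p - fourier g p) = norm (fourier (\<lambda>x. f x - g x) p)"
      using fourier_diff[OF f g] by eventually_elim simp
  qed (intro L2_fields_measurable L2_fields_diff fourier_L2 f g)+
  then show ?thesis by (simp add: fourier_isometry[OF L2_fields_diff[OF f g]])
qed

text \<open>For truncated integrals the translation is an exact identity between kernels.
  Translation invariance of the norm carries it to the limit in the mean.\<close>

lemma fourier_modulate: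
  assumes f: "f \<in> L2_fields"
  shows "(\<lambda>x. exp (- (\<i> * of_real (a \<bullet> x))) *s f x) \<in> L2_fields"
    and "AE p in lborel. fourier (\<lambda>x. exp (- (\<i> * of_real (a \<bullet> x))) *s f x) p = fourier f (p + a)"
proof -
  let ?g = "\<lambda>x. exp (- (\<i> * of_real (a \<bullet> x))) *s f x"
  show g: "?g \<in> L2_fields"
    by (rule L2_unimodular_smult(1)[OF f]) simp_all
  show "AE p in lborel. fourier ?g p = fourier f (p + a)"
  proof (rule fourier_eq_AE[OF g L2_translate(1)[OF fourier_L2[OF f]]])
    have "exp (- (\<i> * of_real (p \<bullet> x))) *s ?g x = exp (- (\<i> * of_real ((p + a) \<bullet> x))) *s f x" for p x
      by (simp add: vec_eq_iff exp_add[symmetric] inner_add_left algebra_simps flip: mult.assoc)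
    then have T: "fourier_truncated R ?g p = fourier_truncated R f (p + a)" for R p
      by (simp only: fourier_truncated_def)
    have "L2_norm (\<lambda>p. fourier_truncated R ?g p - fourier f (p + a)) =
        L2_norm (\<lambda>p. fourier_truncated R f p - fourier f p)" for R
      unfolding T by (rule L2_translate(2)[OF L2_fields_diff[OF fourier_truncated_L2(1)[OF f] fourier_L2[OF f]]])
    then show "((\<lambda>R. L2_norm (\<lambda>p. fourier_truncated R ?g p - fourier f (p + a))) \<longlongrightarrow> 0) at_top"
      using fourier_limit[OF f] by simp
  qed
qed

text \<open>Both fields are truncated at the same radius, where they are integrable and
  \<open>fourier_integral_adjoint\<close> applies; the two sides are then limits of one and the same
  function of the radius.\<close>

lemma fourier_adjoint:
  assumes f: "f \<in> L2_fields" and g: "g \<in> L2_fields"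
  shows "(LINT p|lborel. fourier f p \<bullet> g p) = (LINT x|lborel. f x \<bullet> fourier g (- x))"
proof (rule tendsto_unique)
  let ?c = "\<lambda>f R x. indicator (cball 0 R) x *\<^sub>R f x"
  show "((\<lambda>R. LINT p|lborel. fourier_truncated R f p \<bullet> ?c g R p) \<longlongrightarrow>
      (LINT p|lborel. fourier f p \<bullet> g p)) at_top"
    by (rule L2_inner_tendsto[OF fourier_truncated_L2(1)[OF f] fourier_L2[OF f] L2_indicator(1)[OF g] g
          fourier_limit[OF f] L2_restrict_ball_tendsto[OF g]]) simp
  have refl: "((\<lambda>R. L2_norm (\<lambda>x. fourier_truncated R g (- x) - fourier g (- x))) \<longlongrightarrow> 0) at_top"
    using fourier_limit[OF g]
    by (simp add: L2_reflect(2)[OF L2_fields_diff[OF fourier_truncated_L2(1)[OF g] fourier_L2[OF g]]])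
  have "((\<lambda>R. LINT x|lborel. ?c f R x \<bullet> fourier_truncated R g (- x)) \<longlongrightarrow>
      (LINT x|lborel. f x \<bullet> fourier g (- x))) at_top"
    by (rule L2_inner_tendsto[OF L2_indicator(1)[OF f] f L2_reflect(1)[OF fourier_truncated_L2(1)[OF g]]
          L2_reflect(1)[OF fourier_L2[OF g]] L2_restrict_ball_tendsto[OF f] refl]) simp
  then show "((\<lambda>R. LINT p|lborel. fourier_truncated R f p \<bullet> ?c g R p) \<longlongrightarrow>
      (LINT x|lborel. f x \<bullet> fourier g (- x))) at_top"
    unfolding fourier_truncated_eq
    by (simp only: fourier_integral_adjoint[OF integrable_restrict_ball[OF f] integrable_restrict_ball[OF g]])
qed simp

text \<open>The witness is the formal inverse, the reflected transform of \<open>g\<close>. The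
  adjoint relation makes the inner product of \<open>fourier h\<close> and \<open>g\<close> equal to
  the squared norm of \<open>h\<close>; as all three norms agree, expanding the squared norm of the
  difference gives 0.\<close>

theorem fourier_surj:
  assumes g: "g \<in> L2_fields"
  obtains h where "h \<in> L2_fields" "AE p in lborel. fourier h p = g p"
proof -
  define h where "h x = fourier g (- x)" for x
  have h: "h \<in> L2_fields" and nh: "L2_norm h = L2_norm g"
    using L2_reflect[OF fourier_L2[OF g]] fourier_isometry[OF g] by (simp_all add: h_def[abs_def])
  have "(LINT p|lborel. fourier h p \<bullet> g p) = (L2_norm h)\<^sup>2"
    unfolding fourier_adjoint[OF h g] by (simp add: L2_norm_square power2_norm_eq_inner h_def)
  then have "(L2_norm (\<lambda>p. fourier h p - g p))\<^sup>2 = 0"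
    using L2_norm_diff_square[OF fourier_L2[OF h] g] by (simp add: fourier_isometry[OF h] nh)
  then have "L2_norm (\<lambda>p. fourier h p - g p) = 0" by simp
  from L2_norm_eq_0_AE[OF L2_fields_diff[OF fourier_L2[OF h] g] this]
  have "AE p in lborel. fourier h p = g p" by simp
  with h show ?thesis by (rule that)
qed

text \<open>Surjectivity of the transform supplies the witness for the choice in
  \<open>fourier_multiplier\<close>.\<close>

lemma fourier_multiplier_spec:
  assumes "(\<lambda>p. M p *v fourier \<psi> p) \<in> L2_fields"
  shows "fourier_multiplier M \<psi> \<in> L2_fields"
    "AE p in lborel. fourier (fourier_multiplier M \<psi>) p = M p *v fourier \<psi> p"
proof -
  obtain h where "h \<in> L2_fields \<and> (AE p in lborel. fourier h p = M p *v fourier \<psi> p)"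
    using fourier_surj[OF assms] by blast
  then have "fourier_multiplier M \<psi> \<in> L2_fields \<and>
      (AE p in lborel. fourier (fourier_multiplier M \<psi>) p = M p *v fourier \<psi> p)"
    unfolding fourier_multiplier_def
    by (rule someI[where P = "\<lambda>h. h \<in> L2_fields \<and> (AE p in lborel. fourier h p = M p *v fourier \<psi> p)"])
  then show "fourier_multiplier M \<psi> \<in> L2_fields"
    "AE p in lborel. fourier (fourier_multiplier M \<psi>) p = M p *v fourier \<psi> p" by auto
qed

section \<open>Minimal velocity of a relativistic phase\<close>

definition energy :: "real \<Rightarrow> real^3 \<Rightarrow> real" where
  "energy m p = sqrt ((norm p)\<^sup>2 + m\<^sup>2)"

text \<open>The first component of the gradient of \<open>energy m\<close>, that is, of the
  relativistic group velocity.\<close>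

definition velocity :: "real \<Rightarrow> real^3 \<Rightarrow> real" where
  "velocity m p = (p \<bullet> axis 1 1) / energy m p"

lemma energy_measurable [measurable]: "energy m \<in> borel_measurable borel"
  unfolding energy_def by measurable

lemma velocity_measurable [measurable]: "velocity m \<in> borel_measurable borel"
  unfolding velocity_def by measurable

lemma energy_square: "(energy m p)\<^sup>2 = (norm p)\<^sup>2 + m\<^sup>2"
  by (simp add: energy_def)

lemma energy_pos: "m > 0 \<Longrightarrow> energy m p > 0"
  unfolding energy_def by (intro real_sqrt_gt_zero add_nonneg_pos) simp_all

lemma norm_le_energy: "norm p \<le> energy m p"
  unfolding energy_def by (rule real_le_rsqrt) simp

lemma abs_mass_le_energy: "\<bar>m\<bar> \<le> energy m p"
  unfolding energy_def by (rule real_le_rsqrt) simp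

lemma abs_velocity_le_1:
  assumes "m > 0"
  shows "\<bar>velocity m p\<bar> \<le> 1"
proof -
  have "\<bar>p \<bullet> axis 1 1\<bar> \<le> norm p"
    using Cauchy_Schwarz_ineq2[of p "axis 1 1"] by simp
  then show ?thesis
    using norm_le_energy[of p m] energy_pos[OF assms, of p] by (simp add: velocity_def abs_divide)
qed

text \<open>The mass keeps the radicand positive, so the square root is differentiable at every
  momentum, including 0.\<close>

lemma energy_difference_quotient:
  assumes m: "m > 0"
  shows "((\<lambda>s. (energy m (p + s *\<^sub>R axis 1 1) - energy m p) / s) \<longlongrightarrow> velocity m p) (at 0)"
proof -
  let ?e = "axis 1 1 :: real^3"
  have sq: "energy m (p + s *\<^sub>R ?e) = sqrt ((norm p)\<^sup>2 + 2 * s * (p \<bullet> ?e) + s\<^sup>2 + m\<^sup>2)" for s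
  proof -
    have "(norm (p + s *\<^sub>R ?e))\<^sup>2 = (norm p)\<^sup>2 + 2 * s * (p \<bullet> ?e) + s\<^sup>2"
      unfolding power2_norm_eq_inner
      by (simp add: inner_add_left inner_add_right inner_axis_axis inner_commute[of ?e p] power2_eq_square distrib_left)
    then show ?thesis by (simp add: energy_def)
  qed
  have pos: "(norm p)\<^sup>2 + m\<^sup>2 > 0" using m by (intro add_nonneg_pos) simp_all
  have "((\<lambda>s. sqrt ((norm p)\<^sup>2 + 2 * s * (p \<bullet> ?e) + s\<^sup>2 + m\<^sup>2)) has_field_derivative velocity m p) (at 0)"
    using pos by (auto intro!: derivative_eq_intros simp: velocity_def energy_def field_simps)
  then show ?thesis
    by (simp add: has_field_derivative_iff flip: sq)
qed

lemma norm_exp_i_diff_1_le: "norm (exp (\<i> * of_real r) - 1) \<le> \<bar>r\<bar>"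
  using abs_sin_x_le_abs_x[of "r / 2"] by (simp add: dist_exp_i_1)

text \<open>Under the transform, translation becomes multiplication by a phase that tends to 1
  pointwise, and dominated convergence applies because the phase has modulus 1.\<close>

lemma L2_translate_tendsto:
  assumes f: "f \<in> L2_fields" and X: "X \<longlonglongrightarrow> 0"
  shows "(\<lambda>n. L2_norm (\<lambda>p. f (p + X n) - f p)) \<longlonglongrightarrow> 0"
proof -
  obtain h where h: "h \<in> L2_fields" and Fh: "AE p in lborel. fourier h p = f p"
    using fourier_surj[OF f] by blast
  let ?h = "\<lambda>a x. exp (- (\<i> * of_real (a \<bullet> x))) *s h x"
  have hm: "?h a \<in> L2_fields" for a by (rule fourier_modulate(1)[OF h])
  have eq: "L2_norm (\<lambda>p. f (p + a) - f p) = L2_norm (\<lambda>x. ?h a x - h x)" for a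
  proof -
    have "L2_norm (\<lambda>p. f (p + a) - f p) = L2_norm (\<lambda>p. fourier (?h a) p - fourier h p)"
    proof (rule L2_norm_cong_AE)
      show "AE p in lborel. norm (f (p + a) - f p) = norm (fourier (?h a) p - fourier h p)"
        using Fh AE_lborel_translate[OF Fh, of a] fourier_modulate(2)[OF h, of a] by eventually_elim simp
    qed (intro L2_fields_measurable L2_fields_diff L2_translate(1) fourier_L2 f h hm)+
    then show ?thesis by (simp add: L2_norm_fourier_diff[OF hm h])
  qed
  show ?thesis unfolding eq
  proof (rule L2_dominated_convergence[OF h])
    have "(\<lambda>n. ?h (X n) x) \<longlonglongrightarrow> exp (- (\<i> * of_real (0 \<bullet> x))) *s h x" for x
      by (intro bounded_bilinear.tendsto[OF bounded_bilinear_vector_smult] tendsto_intros X)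
    then show "AE x in lborel. (\<lambda>n. ?h (X n) x) \<longlonglongrightarrow> h x" by simp
  qed (use hm h in \<open>auto simp: norm_vector_smult intro: L2_fields_measurable\<close>)
qed

text \<open>Here \<open>s = 1 / t\<close>, so that large times of either sign become \<open>s \<rightarrow> 0\<close>.\<close>

lemma phase_translate_tendsto:
  assumes m: "m > 0" and f: "f \<in> L2_fields"
  shows "((\<lambda>s. L2_norm (\<lambda>p. exp (\<i> * of_real (energy m (p + s *\<^sub>R axis 1 1) / s)) *s f (p + s *\<^sub>R axis 1 1) -
      exp (\<i> * of_real (energy m p / s)) *s (exp (\<i> * of_real (velocity m p)) *s f p))) \<longlongrightarrow> 0) (at 0)"
  unfolding tendsto_at_iff_sequentially
proof (intro allI impI)
  fix X :: "nat \<Rightarrow> real"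
  assume X0: "\<forall>i. X i \<in> UNIV - {0}" and X: "X \<longlonglongrightarrow> 0"
  let ?e = "axis 1 1 :: real^3"
  note [measurable] = L2_fields_measurable[OF f]
  define a where "a n p = exp (\<i> * of_real (energy m (p + X n *\<^sub>R ?e) / X n))" for n p
  define b where "b n p = exp (\<i> * of_real (energy m p / X n))" for n p
  define v where "v p = exp (\<i> * of_real (velocity m p))" for p
  \<comment> \<open>The phases \<open>a n\<close> and \<open>b n\<close> oscillate ever faster and
    have no limit. Their quotient \<open>q n\<close> contains the difference quotient of the energy
    and tends to \<open>v\<close>.\<close>
  define q where "q n p = exp (\<i> * of_real ((energy m (p + X n *\<^sub>R ?e) - energy m p) / X n))" for n p
  have [measurable]: "a n \<in> borel_measurable borel" "b n \<in> borel_measurable borel"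
    "v \<in> borel_measurable borel" "q n \<in> borel_measurable borel" for n
    unfolding a_def b_def v_def q_def by measurable
  have n1: "norm (a n p) = 1" "norm (b n p) = 1" "norm (v p) = 1" "norm (q n p) = 1" for n p
    by (simp_all add: a_def b_def v_def q_def)
  have aL: "(\<lambda>p. a n p *s g p) \<in> L2_fields" and bL: "(\<lambda>p. b n p *s g p) \<in> L2_fields"
    and vL: "(\<lambda>p. v p *s g p) \<in> L2_fields" and qL: "(\<lambda>p. q n p *s g p) \<in> L2_fields"
    and aN: "L2_norm (\<lambda>p. a n p *s g p) = L2_norm g" and bN: "L2_norm (\<lambda>p. b n p *s g p) = L2_norm g"
    if "g \<in> L2_fields" for n g
    by (rule L2_unimodular_smult[OF that]; simp add: n1)+
  interpret smult: bounded_bilinear "\<lambda>(c::complex) (v::complex^4). c *s v"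
    by (rule bounded_bilinear_vector_smult)
  \<comment> \<open>The intermediate field is \<open>a n p *s f p\<close>: one step undoes the
    translation of \<open>f\<close> under a phase of modulus 1, the other factors out
    \<open>b n\<close> and compares \<open>q n\<close> with \<open>v\<close>.\<close>
  have le: "L2_norm (\<lambda>p. a n p *s f (p + X n *\<^sub>R ?e) - b n p *s (v p *s f p)) \<le>
      L2_norm (\<lambda>p. f (p + X n *\<^sub>R ?e) - f p) + L2_norm (\<lambda>p. q n p *s f p - v p *s f p)" for n
  proof -
    have ab: "a n p *s f p = b n p *s (q n p *s f p)" for p
    proof -
      have "energy m p / X n + (energy m (p + X n *\<^sub>R ?e) - energy m p) / X n = energy m (p + X n *\<^sub>R ?e) / X n"
        by (simp add: diff_divide_distrib)
      then have "a n p = b n p * q n p"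
        unfolding a_def b_def q_def
        by (simp only: exp_add[symmetric] distrib_left[symmetric] of_real_add[symmetric])
      then show ?thesis by (simp add: vec_eq_iff)
    qed
    have "L2_norm (\<lambda>p. a n p *s f (p + X n *\<^sub>R ?e) - a n p *s f p) = L2_norm (\<lambda>p. f (p + X n *\<^sub>R ?e) - f p)"
      using aN[OF L2_fields_diff[OF L2_translate(1)[OF f] f]] by (simp add: smult.diff_right)
    moreover have "L2_norm (\<lambda>p. a n p *s f p - b n p *s (v p *s f p)) = L2_norm (\<lambda>p. q n p *s f p - v p *s f p)"
      unfolding ab using bN[OF L2_fields_diff[OF qL[OF f] vL[OF f]]] by (simp add: smult.diff_right)
    ultimately show ?thesis
      using L2_norm_triangle_diff[OF aL[OF L2_translate(1)[OF f, of "X n *\<^sub>R ?e"], of n] aL[OF f, of n] bL[OF vL[OF f], of n]]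
      by linarith
  qed
  have "(\<lambda>n. X n *\<^sub>R ?e) \<longlonglongrightarrow> 0" using X by (auto intro!: tendsto_eq_intros)
  note lim1 = L2_translate_tendsto[OF f this]
  have lim2: "(\<lambda>n. L2_norm (\<lambda>p. q n p *s f p - v p *s f p)) \<longlonglongrightarrow> 0"
  proof (rule L2_dominated_convergence[OF f])
    have "(\<lambda>n. (energy m (p + X n *\<^sub>R ?e) - energy m p) / X n) \<longlonglongrightarrow> velocity m p" for p
      using energy_difference_quotient[OF m, of p, unfolded tendsto_at_iff_sequentially] X X0
      by (auto simp: o_def)
    then have "(\<lambda>n. q n p *s f p) \<longlonglongrightarrow> v p *s f p" for p
      unfolding q_def v_def by (intro smult.tendsto tendsto_intros)
    then show "AE p in lborel. (\<lambda>n. q n p *s f p) \<longlonglongrightarrow> v p *s f p" by simp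
  qed (auto simp: norm_vector_smult n1)
  have "(\<lambda>n. L2_norm (\<lambda>p. a n p *s f (p + X n *\<^sub>R ?e) - b n p *s (v p *s f p))) \<longlonglongrightarrow> 0"
    by (rule tendsto_sandwich[OF _ _ tendsto_const tendsto_add_zero[OF lim1 lim2]]) (simp, intro always_eventually allI le)
  then show "((\<lambda>s. L2_norm (\<lambda>p. exp (\<i> * of_real (energy m (p + s *\<^sub>R ?e) / s)) *s f (p + s *\<^sub>R ?e) -
      exp (\<i> * of_real (energy m p / s)) *s (exp (\<i> * of_real (velocity m p)) *s f p))) \<circ> X) \<longlonglongrightarrow> 0"
    by (simp add: o_def a_def b_def v_def)
qed

text \<open>The velocity is at most 1 in modulus, hence strictly between \<open>- pi\<close> and
  \<open>pi\<close>, so the phase is 1 only where the velocity is 0. That set is the hyperplane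
  \<open>p $ 1 = 0\<close>.\<close>

lemma AE_velocity_phase_neq_1:
  assumes m: "m > 0"
  shows "AE p in lborel. exp (\<i> * of_real (velocity m p)) \<noteq> 1"
proof -
  have "AE p in lebesgue. p \<notin> {p::real^3. p $ 1 = 0}"
    by (rule AE_not_in) (use negligible_standard_hyperplane_cart in \<open>simp add: negligible_iff_null_sets\<close>)
  then have "AE p in lborel. (p :: real^3) $ 1 \<noteq> 0"
    by (simp add: AE_completion_iff)
  then show ?thesis
  proof eventually_elim
    case (elim p)
    show ?case
    proof
      assume "exp (\<i> * of_real (velocity m p)) = 1"
      then have "sin (velocity m p) = 0"
        using Im_exp[of "\<i> * of_real (velocity m p)"] by simp
      moreover have "- pi < velocity m p" "velocity m p < pi"
        using abs_velocity_le_1[OF m, of p] pi_gt3 by auto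
      ultimately have "velocity m p = 0" using sin_eq_0_pi by blast
      then show False
        using elim energy_pos[OF m, of p] by (simp add: velocity_def inner_axis)
    qed
  qed
qed

text \<open>Division by the phase factor is possible almost everywhere but unbounded, so it is
  truncated. The norm of \<open>g\<close> is therefore not controlled by \<open>e\<close>; its size
  later determines how small the speed of the ball has to be.\<close>

lemma velocity_phase_dense:
  assumes m: "m > 0" and f: "f \<in> L2_fields" and e: "e > 0"
  obtains g where "g \<in> L2_fields"
    "L2_norm (\<lambda>p. (exp (\<i> * of_real (velocity m p)) - 1) *s g p - f p) < e"
proof -
  note [measurable] = L2_fields_measurable[OF f]
  define k where "k p = exp (\<i> * of_real (velocity m p)) - 1" for p
  have [measurable]: "k \<in> borel_measurable borel" unfolding k_def by measurable
  \<comment> \<open>The threshold bounds \<open>c n\<close> by \<open>Suc n\<close>, and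
    \<open>k p * c n p\<close> is either 0 or 1, so the products are dominated by
    \<open>f\<close>.\<close>
  define c where "c n p = (if norm (k p) \<ge> 1 / real (Suc n) then 1 / k p else 0)" for n p
  have [measurable]: "c n \<in> borel_measurable borel" for n unfolding c_def by measurable
  have cL: "(\<lambda>p. c n p *s f p) \<in> L2_fields" for n
  proof (rule L2_bounded_smult(1)[OF f])
    show "norm (c n p) \<le> real (Suc n)" for p
    proof (cases "norm (k p) \<ge> 1 / real (Suc n)")
      case True
      then have "norm (k p) > 0" by (smt (verit) of_nat_0_less_iff zero_less_Suc zero_less_divide_1_iff)
      with True show ?thesis by (simp add: c_def norm_divide field_simps del: of_nat_Suc)
    qed (simp add: c_def)
  qed simp_all
  have "(\<lambda>n. L2_norm (\<lambda>p. k p *s (c n p *s f p) - f p)) \<longlonglongrightarrow> 0"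
  proof (rule L2_dominated_convergence[OF f])
    show "AE p in lborel. (\<lambda>n. k p *s (c n p *s f p)) \<longlonglongrightarrow> f p"
      using AE_velocity_phase_neq_1[OF m]
    proof eventually_elim
      case (elim p)
      then have k: "norm (k p) > 0" by (simp add: k_def)
      show ?case
      proof (rule tendsto_eventually)
        obtain N where N: "1 / real (Suc N) < norm (k p)"
          using k by (meson nat_approx_posE)
        have "k p *s (c n p *s f p) = f p" if "n \<ge> N" for n
        proof -
          have "1 / real (Suc n) \<le> 1 / real (Suc N)" using that by (simp add: frac_le)
          then show ?thesis using N k by (simp add: c_def vec_eq_iff)
        qed
        then show "\<forall>\<^sub>F n in sequentially. k p *s (c n p *s f p) = f p"
          unfolding eventually_sequentially by blast
      qed
    qed
    have "norm (k p * c n p) \<le> 1" for n p by (simp add: c_def norm_mult norm_divide)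
    then have "norm (k p *s (c n p *s f p)) \<le> norm (f p)" for n p
      using mult_right_mono[of "norm (k p * c n p)" 1 "norm (f p)"]
      by (simp add: norm_vector_smult norm_mult mult.assoc)
    then show "AE p in lborel. norm (k p *s (c n p *s f p)) \<le> norm (f p)" for n by simp
  qed auto
  from LIMSEQ_D[OF this e] obtain n where "L2_norm (\<lambda>p. k p *s (c n p *s f p) - f p) < e" by auto
  with cL show ?thesis by (intro that[of "\<lambda>p. c n p *s f p"]) (simp_all add: k_def)
qed

text \<open>Up to small errors the field at time \<open>t\<close> is \<open>(exp (- i x\<^sub>1 / t) - 1) w\<close> with \<open>w\<close> of bounded
  norm, and the multiplier is at most \<open>v\<close> on the ball of radius \<open>v \<bar>t\<bar>\<close>.\<close>

theorem phase_escapes_ball: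
  assumes m: "m > 0" and f: "f \<in> L2_fields" and \<epsilon>: "\<epsilon> > 0"
  obtains v \<tau> where "0 < v" "v < 1" "\<tau> > 0"
    "\<And>t u. \<bar>t\<bar> \<ge> \<tau> \<Longrightarrow> u \<in> L2_fields \<Longrightarrow>
      (AE p in lborel. fourier u p = exp (\<i> * of_real (t * energy m p)) *s f p) \<Longrightarrow>
      L2_norm (\<lambda>x. indicator (cball 0 (v * \<bar>t\<bar>)) x *\<^sub>R u x) \<le> \<epsilon>"
proof -
  let ?e = "axis 1 1 :: real^3"
  \<comment> \<open>Error budget: a quarter for replacing \<open>f\<close> by a multiple of
    \<open>g\<close>, a quarter for the translated phase, and a half for the small multiplier on the
    ball.\<close>
  have "\<epsilon> / 4 > 0" using \<epsilon> by simp
  then obtain g where g: "g \<in> L2_fields"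
    and gf: "L2_norm (\<lambda>p. (exp (\<i> * of_real (velocity m p)) - 1) *s g p - f p) < \<epsilon> / 4"
    using velocity_phase_dense[OF m f] by blast
  define d where "d s p = exp (\<i> * of_real (energy m (p + s *\<^sub>R ?e) / s)) *s g (p + s *\<^sub>R ?e) -
      exp (\<i> * of_real (energy m p / s)) *s (exp (\<i> * of_real (velocity m p)) *s g p)" for s p
  have "((\<lambda>s. L2_norm (d s)) \<longlongrightarrow> 0) (at 0)"
    unfolding d_def by (rule phase_translate_tendsto[OF m g])
  then obtain \<delta> where \<delta>: "\<delta> > 0" and d: "\<And>s. s \<noteq> 0 \<Longrightarrow> \<bar>s\<bar> < \<delta> \<Longrightarrow> L2_norm (d s) < \<epsilon> / 4"
    using LIM_D[of "\<lambda>s. L2_norm (d s)" 0 0 "\<epsilon> / 4"] \<epsilon> by auto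
  \<comment> \<open>The summand 1 avoids division by 0 when \<open>g\<close> has norm 0, and the
    minimum with \<open>1 / 2\<close> keeps the speed below 1.\<close>
  define v where "v = min (1 / 2) (\<epsilon> / (2 * (L2_norm g + 1)))"
  have v0: "0 < v" "v < 1" unfolding v_def using \<epsilon> L2_norm_nonneg[of g]
    by (auto simp: min_less_iff_disj intro!: divide_pos_pos add_nonneg_pos)
  have vg: "v * L2_norm g \<le> \<epsilon> / 2"
  proof -
    have n: "L2_norm g + 1 > 0" by (intro add_nonneg_pos) simp_all
    have "v * L2_norm g \<le> \<epsilon> / (2 * (L2_norm g + 1)) * (L2_norm g + 1)"
      unfolding v_def using \<epsilon> n by (intro mult_mono) auto
    also have "\<dots> = \<epsilon> / 2"
    proof -
      have "\<epsilon> / (2 * a) * a = \<epsilon> / 2" if "a > 0" for a using that by simp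
      from this[OF n] show ?thesis .
    qed
    finally show ?thesis .
  qed
  \<comment> \<open>The factor 2 makes \<open>1 / t\<close> strictly smaller than
    \<open>\<delta>\<close> in modulus even when \<open>\<bar>t\<bar> = \<tau>\<close>.\<close>
  define \<tau> where "\<tau> = 2 / \<delta>"
  have \<tau>: "\<tau> > 0" using \<delta> by (simp add: \<tau>_def)
  have "L2_norm (\<lambda>x. indicator (cball 0 (v * \<bar>t\<bar>)) x *\<^sub>R u x) \<le> \<epsilon>"
    if t: "\<bar>t\<bar> \<ge> \<tau>" and u: "u \<in> L2_fields"
      and Fu: "AE p in lborel. fourier u p = exp (\<i> * of_real (t * energy m p)) *s f p" for t u
  proof -
    define s where "s = 1 / t"
    have t0: "t \<noteq> 0" using t \<tau> by auto
    have s: "s \<noteq> 0" "\<bar>s\<bar> < \<delta>"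
    proof -
      show "s \<noteq> 0" using t0 by (simp add: s_def)
      have "\<delta> * \<bar>t\<bar> \<ge> 2" using t \<delta> by (simp add: \<tau>_def field_simps)
      then show "\<bar>s\<bar> < \<delta>" using t0 by (simp add: s_def field_simps)
    qed
    have phase: "energy m p / s = t * energy m p" for p by (simp add: s_def)
    let ?E = "\<lambda>p. exp (\<i> * of_real (t * energy m p))"
    have EL: "(\<lambda>p. ?E p *s h p) \<in> L2_fields" and EN: "L2_norm (\<lambda>p. ?E p *s h p) = L2_norm h"
      if "h \<in> L2_fields" for h
      by (rule L2_unimodular_smult[OF that]; simp)+
    \<comment> \<open>This is the evolved field with profile \<open>g\<close> in place of
      \<open>f\<close>; its norm is that of \<open>g\<close> at every time.\<close>
    obtain w where w: "w \<in> L2_fields" and Fw: "AE p in lborel. fourier w p = ?E p *s g p"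
      using fourier_surj[OF EL[OF g]] by blast
    have Nw: "L2_norm w = L2_norm g"
    proof -
      have "L2_norm (fourier w) = L2_norm (\<lambda>p. ?E p *s g p)"
        using Fw by (intro L2_norm_cong_AE L2_fields_measurable fourier_L2 w EL g) auto
      then show ?thesis by (simp only: fourier_isometry[OF w] EN[OF g])
    qed
    define w' where "w' x = exp (- (\<i> * of_real ((s *\<^sub>R ?e) \<bullet> x))) *s w x" for x
    have w': "w' \<in> L2_fields" and Fw': "AE p in lborel. fourier w' p = fourier w (p + s *\<^sub>R ?e)"
      unfolding w'_def by (rule fourier_modulate[OF w])+
    define y where "y x = w' x - w x" for x
    have y: "y \<in> L2_fields" unfolding y_def by (rule L2_fields_diff[OF w' w])
    have Fy: "AE p in lborel. fourier y p = fourier w' p - fourier w p"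
      unfolding y_def by (rule fourier_diff[OF w' w])
    let ?r = "\<lambda>p. (exp (\<i> * of_real (velocity m p)) - 1) *s g p - f p"
    have kL: "(\<lambda>p. (exp (\<i> * of_real (velocity m p)) - 1) *s g p) \<in> L2_fields"
      by (rule L2_bounded_smult(1)[OF g, of _ 2])
         (auto intro!: order_trans[OF norm_triangle_ineq4])
    have rL: "?r \<in> L2_fields" by (rule L2_fields_diff[OF kL f])
    have dL: "d s \<in> L2_fields"
    proof -
      note [measurable] = L2_fields_measurable[OF g]
      have "(\<lambda>p. exp (\<i> * of_real (energy m (p + s *\<^sub>R ?e) / s)) *s g (p + s *\<^sub>R ?e)) \<in> L2_fields"
        by (rule L2_unimodular_smult(1)[OF L2_translate(1)[OF g]]) simp_all
      moreover have "(\<lambda>p. exp (\<i> * of_real (energy m p / s)) *s (exp (\<i> * of_real (velocity m p)) *s g p)) \<in> L2_fields"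
        by (intro L2_unimodular_smult(1) g) simp_all
      ultimately show ?thesis unfolding d_def by (rule L2_fields_diff)
    qed
    \<comment> \<open>The error splits into \<open>d s\<close>, which exchanges the momentum
      translation for the velocity phase, and \<open>?r\<close>, which exchanges the resulting
      multiple of \<open>g\<close> for \<open>f\<close>.\<close>
    have diff: "AE p in lborel. fourier y p - fourier u p = d s p + ?E p *s ?r p"
      using Fu Fw AE_lborel_translate[OF Fw, of "s *\<^sub>R ?e"] Fw' Fy
    proof eventually_elim
      case (elim p)
      then have "fourier y p - fourier u p = ?E (p + s *\<^sub>R ?e) *s g (p + s *\<^sub>R ?e) - ?E p *s g p - ?E p *s f p"
        by simp
      then show ?case
        by (simp add: d_def phase vec_eq_iff algebra_simps)
    qed
    have "L2_norm (\<lambda>x. y x - u x) = L2_norm (\<lambda>p. d s p + ?E p *s ?r p)"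
      unfolding L2_norm_fourier_diff[OF y u, symmetric]
      by (rule L2_norm_cong_AE[OF L2_fields_measurable[OF L2_fields_diff[OF fourier_L2[OF y] fourier_L2[OF u]]]
            L2_fields_measurable[OF L2_fields_add[OF dL EL[OF rL]]]])
         (use diff in auto)
    also have "\<dots> \<le> L2_norm (d s) + L2_norm (\<lambda>p. ?E p *s ?r p)"
      by (rule L2_norm_triangle[OF dL EL[OF rL]])
    also have "\<dots> \<le> \<epsilon> / 2"
      using d[OF s] gf EN[OF rL] by simp
    finally have uy: "L2_norm (\<lambda>x. u x - y x) \<le> \<epsilon> / 2"
      by (simp add: L2_norm_minus_commute[of u])
    let ?B = "cball (0::real^3) (v * \<bar>t\<bar>)"
    have B: "?B \<in> sets borel" by simp
    have "L2_norm (\<lambda>x. indicator ?B x *\<^sub>R y x) \<le> v * L2_norm w"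
    proof (rule L2_dominated(2)[OF w])
      show "(\<lambda>x. indicator ?B x *\<^sub>R y x) \<in> borel_measurable borel"
        by (rule L2_fields_measurable[OF L2_indicator(1)[OF y B]])
      have "norm (indicator ?B x *\<^sub>R y x) \<le> v * norm (w x)" for x
      proof (cases "x \<in> ?B")
        case True
        have "\<bar>?e \<bullet> x\<bar> \<le> v * \<bar>t\<bar>"
          using Cauchy_Schwarz_ineq2[of ?e x] True by simp
        then have "\<bar>s * (?e \<bullet> x)\<bar> \<le> v"
          using t0 by (simp add: s_def abs_mult field_simps)
        moreover have "norm (exp (- (\<i> * of_real ((s *\<^sub>R ?e) \<bullet> x))) - 1) \<le> \<bar>s * (?e \<bullet> x)\<bar>"
          using norm_exp_i_diff_1_le[of "- (s * (?e \<bullet> x))"] by simp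
        moreover have "y x = (exp (- (\<i> * of_real ((s *\<^sub>R ?e) \<bullet> x))) - 1) *s w x"
          by (simp add: y_def w'_def vec_eq_iff algebra_simps)
        ultimately have "norm (y x) \<le> v * norm (w x)"
          by (simp only: norm_vector_smult) (intro mult_right_mono, linarith, simp)
        then show ?thesis using True by simp
      qed (use v0 in simp)
      then show "AE x in lborel. norm (indicator ?B x *\<^sub>R y x) \<le> v * norm (w x)" by simp
    qed (use v0 in simp)
    then have yB: "L2_norm (\<lambda>x. indicator ?B x *\<^sub>R y x) \<le> \<epsilon> / 2" using Nw vg by simp
    have "L2_norm (\<lambda>x. indicator ?B x *\<^sub>R u x) \<le>
        L2_norm (\<lambda>x. indicator ?B x *\<^sub>R (u x - y x)) + L2_norm (\<lambda>x. indicator ?B x *\<^sub>R y x)"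
      using L2_norm_triangle[OF L2_indicator(1)[OF L2_fields_diff[OF u y] B] L2_indicator(1)[OF y B]]
      by (simp add: algebra_simps)
    also have "L2_norm (\<lambda>x. indicator ?B x *\<^sub>R (u x - y x)) \<le> L2_norm (\<lambda>x. u x - y x)"
      by (rule L2_indicator(2)[OF L2_fields_diff[OF u y] B])
    finally show ?thesis using uy yB by simp
  qed
  with v0 \<tau> show ?thesis by (rule that)
qed

section \<open>The exponential of the Dirac symbol\<close>

text \<open>Complex scalars act on matrices in the form \<open>mat c ** A\<close>, as in the
  exponent of \<open>dirac_evolution\<close>.\<close>

lemma mat_mult_nth [simp]: "(mat c ** A) $ i $ j = c * (A $ i $ j)"
  for A :: "complex^'n^'n"
  by (simp add: matrix_matrix_mult_def mat_def if_distrib[of "\<lambda>x. x * _"] cong: if_cong)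

lemma mat_mult_vec: "(mat c ** A) *v x = c *s (A *v x)"
  for A :: "complex^'n^'n"
  by (simp add: vec_eq_iff matrix_vector_mult_def sum_distrib_left mult.assoc)

lemma mat_mult_mat: "mat c ** (mat d ** A) = mat (c * d) ** A"
  for A :: "complex^'n^'n"
  by (simp add: vec_eq_iff mult.assoc)

lemma mat_mult_commute: "A ** (mat c ** B) = mat c ** (A ** B)"
  for A B :: "complex^'n^'n"
proof -
  have nth: "(M ** N) $ i $ j = (\<Sum>k\<in>UNIV. M $ i $ k * N $ k $ j)" for M N :: "complex^'n^'n" and i j
    by (simp add: matrix_matrix_mult_def)
  show ?thesis
    by (simp add: vec_eq_iff nth[of A] sum_distrib_left mult.left_commute)
qed

lemma matrix_mult_add_right: "A ** (B + C) = A ** B + A ** C"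
  for A B C :: "complex^'n^'n"
  by (simp add: vec_eq_iff matrix_matrix_mult_def distrib_left sum.distrib)

lemma matrix_mult_add_left: "(A + B) ** C = A ** C + B ** C"
  for A B C :: "complex^'n^'n"
  by (simp add: vec_eq_iff matrix_matrix_mult_def distrib_right sum.distrib)

lemma matrix_mult_diff_right: "A ** (B - C) = A ** B - A ** C"
  for A B C :: "complex^'n^'n"
  by (simp add: vec_eq_iff matrix_matrix_mult_def right_diff_distrib sum_subtractf)

lemma matrix_mult_scaleR_right: "A ** (r *\<^sub>R B) = r *\<^sub>R (A ** B)"
  for A B :: "complex^'n^'n"
  by (simp add: vec_eq_iff matrix_matrix_mult_def scaleR_sum_right)

lemma matrix_mult_scaleR_left: "(r *\<^sub>R A) ** B = r *\<^sub>R (A ** B)"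
  for A B :: "complex^'n^'n"
  by (simp add: vec_eq_iff matrix_matrix_mult_def scaleR_sum_right)

lemma bounded_linear_mat_mult: "bounded_linear (\<lambda>c. mat c ** A)"
  for A :: "complex^'n^'n"
  by (rule linear_conv_bounded_linear[THEN iffD1], rule linearI)
     (simp_all add: vec_eq_iff distrib_right)

text \<open>Since \<open>(1/E) *\<^sub>R A\<close> squares to the identity, the two half-sums are
  the spectral projections for the eigenvalues \<open>E\<close> and \<open>- E\<close>. They add up
  to \<open>mat 1\<close>, the start of the iteration, and \<open>A\<close> acts on each as a
  scalar, so the matrix series becomes two scalar exponential series.\<close>

lemma matrix_exp_involution:
  fixes A :: "complex^'n^'n"
  assumes E: "E \<noteq> 0" and sq: "A ** A = E\<^sup>2 *\<^sub>R mat 1"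
  shows "matrix_exp (mat c ** A) =
    mat (exp (c * of_real E)) ** ((1/2) *\<^sub>R (mat 1 + (1/E) *\<^sub>R A)) +
    mat (exp (- (c * of_real E))) ** ((1/2) *\<^sub>R (mat 1 - (1/E) *\<^sub>R A))"
proof -
  define P where "P = (1/2) *\<^sub>R (mat 1 + (1/E) *\<^sub>R A)"
  define Q where "Q = (1/2) *\<^sub>R (mat 1 - (1/E) *\<^sub>R A)"
  have EE: "E\<^sup>2 / E = E" using E by (simp add: power2_eq_square)
  have AP: "A ** P = mat (of_real E) ** P"
  proof -
    have "A ** P = E *\<^sub>R P"
      using E by (simp add: P_def matrix_mult_scaleR_right matrix_mult_add_right sq EE scaleR_add_right add.commute)
    also have "\<dots> = mat (of_real E) ** P" by (simp add: vec_eq_iff) (simp add: scaleR_conv_of_real)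
    finally show ?thesis .
  qed
  have AQ: "A ** Q = mat (- of_real E) ** Q"
  proof -
    have "A ** Q = - (E *\<^sub>R Q)"
      using E by (simp add: Q_def matrix_mult_scaleR_right matrix_mult_diff_right sq EE scaleR_diff_right)
    also have "\<dots> = mat (- of_real E) ** Q" by (simp add: vec_eq_iff) (simp add: scaleR_conv_of_real)
    finally show ?thesis .
  qed
  have one: "(mat c ** A) ** (mat z ** R) = mat (c * (z * d)) ** R" if "A ** R = mat d ** R" for z d and R :: "complex^'n^'n"
    by (simp only: matrix_mul_assoc[symmetric, of "mat c" A] mat_mult_commute[of A] that mat_mult_mat)
  have step: "(mat c ** A) ** (mat z ** P + mat w ** Q) =
      mat (c * of_real E * z) ** P + mat (- (c * of_real E) * w) ** Q" for z w
    by (simp only: matrix_mult_add_right one[OF AP] one[OF AQ]) (simp add: mult_ac)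
  have pow: "((\<lambda>B. (mat c ** A) ** B) ^^ n) (mat 1) =
      mat ((c * of_real E) ^ n) ** P + mat ((- (c * of_real E)) ^ n) ** Q" for n
  proof (induction n)
    case 0
    have "P + Q = mat 1" by (simp add: P_def Q_def scaleR_add_right[symmetric] flip: scaleR_2)
    then show ?case by simp
  next
    case (Suc n)
    then show ?case by (simp add: step)
  qed
  have "(\<lambda>n. (1 / fact n) *\<^sub>R (mat ((c * of_real E) ^ n) ** P + mat ((- (c * of_real E)) ^ n) ** Q)) sums
      (mat (exp (c * of_real E)) ** P + mat (exp (- (c * of_real E))) ** Q)"
  proof -
    have s: "(\<lambda>n. (1 / fact n) *\<^sub>R (mat (z ^ n) ** B)) sums (mat (exp z) ** B)"
      for z and B :: "complex^'n^'n"
      using bounded_linear.sums[OF bounded_linear_mat_mult exp_converges[of z], of B]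
      by (simp add: linear_simps(5)[OF bounded_linear_mat_mult] inverse_eq_divide)
    show ?thesis
      unfolding scaleR_add_right by (intro sums_add s)
  qed
  then show ?thesis
    unfolding matrix_exp_def pow P_def[symmetric] Q_def[symmetric] by (rule sums_unique[symmetric])
qed

text \<open>The anticommutation relations cancel all cross terms, and each matrix squares to the
  identity. Hence the symbol can only have plus or minus the energy as eigenvalues.\<close>

lemma dirac_symbol_square:
  assumes "dirac_matrices \<alpha> \<beta>"
  shows "dirac_symbol \<alpha> \<beta> m p ** dirac_symbol \<alpha> \<beta> m p = (energy m p)\<^sup>2 *\<^sub>R mat 1"
proof -
  have two: "(mat 2 :: complex^4^4) = 2 *\<^sub>R mat 1"
    by (simp add: vec_eq_iff mat_def scaleR_2)
  have anti: "\<alpha> j ** \<alpha> k + \<alpha> k ** \<alpha> j = (if j = k then 2 *\<^sub>R mat 1 else 0)" for j k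
    using assms two by (simp add: dirac_matrices_def)
  have sq: "\<alpha> k ** \<alpha> k = mat 1" for k
  proof -
    have "2 *\<^sub>R (\<alpha> k ** \<alpha> k) = 2 *\<^sub>R mat 1" using anti[of k k] by (simp add: scaleR_2)
    then show ?thesis by simp
  qed
  have swap: "\<alpha> j ** \<alpha> k = - (\<alpha> k ** \<alpha> j)" if "j \<noteq> k" for j k
    using anti[of j k] that by (simp add: eq_neg_iff_add_eq_0)
  have \<beta>: "\<beta> ** \<alpha> k = - (\<alpha> k ** \<beta>)" "\<beta> ** \<beta> = mat 1" for k
    using assms by (auto simp: dirac_matrices_def eq_neg_iff_add_eq_0 add.commute)
  have energy: "energy m p * energy m p = p $ 1 * p $ 1 + p $ 2 * p $ 2 + p $ 3 * p $ 3 + m * m"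
    using energy_square[of m p] unfolding power2_norm_eq_inner
    by (simp add: inner_vec_def sum_3 power2_eq_square)
  show ?thesis
    \<comment> \<open>The instances of \<open>swap\<close> are oriented towards increasing indices,
      so that rewriting terminates and the cross terms meet with opposite signs.\<close>
    by (simp add: dirac_symbol_def sum_3 matrix_mult_add_left matrix_mult_add_right
        matrix_mult_scaleR_left matrix_mult_scaleR_right sq \<beta> swap[of 2 1] swap[of 3 1] swap[of 3 2]
        energy scaleR_add_left power2_eq_square algebra_simps)
qed

section \<open>The Dirac evolution in momentum space\<close>

lemma bounded_linear_matrix_vector:
  "bounded_linear ((*v) A)" for A :: "complex^'n^'m"
  by (rule linear_conv_bounded_linear[THEN iffD1], rule linearI)
     (simp_all add: vec_eq_iff matrix_vector_mult_def distrib_left sum.distrib scaleR_sum_right)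

lemma L2_matrix_vector:
  assumes f: "f \<in> L2_fields"
  shows "(\<lambda>p. A *v f p) \<in> L2_fields"
proof -
  obtain K where K: "\<And>x. norm (A *v x) \<le> norm x * K" "K \<ge> 0"
    using bounded_linear.nonneg_bounded[OF bounded_linear_matrix_vector[of A]] by blast
  note [measurable] = L2_fields_measurable[OF f]
  have "(\<lambda>p. A *v f p) \<in> borel_measurable borel"
    using measurable_compose[OF L2_fields_measurable[OF f] borel_measurable_continuous_onI[OF
        linear_continuous_on[OF bounded_linear_matrix_vector]]] .
  then show ?thesis
    by (rule L2_dominated(1)[OF f _ _ K(2)]) (intro AE_I2, subst mult.commute, rule K(1))
qed

text \<open>The symbol itself is unbounded, but after division by the energy it is a sum of constant
  matrices whose scalar coefficients have modulus at most 1.\<close>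

lemma L2_dirac_symbol:
  assumes m: "m > 0" and f: "f \<in> L2_fields"
  shows "(\<lambda>p. ((1 / energy m p) *\<^sub>R dirac_symbol \<alpha> \<beta> m p) *v f p) \<in> L2_fields"
proof -
  have bounded: "(\<lambda>p. r p *\<^sub>R g p) \<in> L2_fields"
    if g: "g \<in> L2_fields" and [measurable]: "r \<in> borel_measurable borel" and le: "\<And>p. \<bar>r p\<bar> \<le> 1"
    for r :: "real^3 \<Rightarrow> real" and g
  proof -
    note [measurable] = L2_fields_measurable[OF g]
    have "norm (r p *\<^sub>R g p) \<le> 1 * norm (g p)" for p
      using mult_right_mono[OF le[of p], of "norm (g p)"] by simp
    then show ?thesis by (intro L2_dominated(1)[OF g, where C = 1]) simp_all
  qed
  have "(\<lambda>p. (p $ k / energy m p) *\<^sub>R (\<alpha> k *v f p)) \<in> L2_fields" for k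
  proof (rule bounded[OF L2_matrix_vector[OF f]])
    show "\<bar>p $ k / energy m p\<bar> \<le> 1" for p
      using component_le_norm_cart[of p k] norm_le_energy[of p m] energy_pos[OF m, of p]
      by (simp add: abs_divide)
  qed measurable
  moreover have "(\<lambda>p. (m / energy m p) *\<^sub>R (\<beta> *v f p)) \<in> L2_fields"
  proof (rule bounded[OF L2_matrix_vector[OF f]])
    show "\<bar>m / energy m p\<bar> \<le> 1" for p
      using abs_mass_le_energy[of m p] energy_pos[OF m, of p] by (simp add: abs_divide)
  qed measurable
  moreover have "((1 / energy m p) *\<^sub>R dirac_symbol \<alpha> \<beta> m p) *v f p =
      (p $ 1 / energy m p) *\<^sub>R (\<alpha> 1 *v f p) + (p $ 2 / energy m p) *\<^sub>R (\<alpha> 2 *v f p) +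
      (p $ 3 / energy m p) *\<^sub>R (\<alpha> 3 *v f p) + (m / energy m p) *\<^sub>R (\<beta> *v f p)" for p
  proof -
    have s: "(r *\<^sub>R A) *v x = r *\<^sub>R (A *v x)" for r and A :: "complex^4^4" and x
      by (simp add: vec_eq_iff matrix_vector_mult_def scaleR_sum_right)
    show ?thesis
      by (simp add: dirac_symbol_def sum_3 s scaleR_add_right matrix_vector_mult_add_rdistrib)
  qed
  ultimately show ?thesis by (simp add: L2_fields_add)
qed

text \<open>The fields \<open>f\<close> and \<open>g\<close> are the positive and negative energy
  parts of \<open>fourier \<psi>\<close> and do not depend on time. The second phase is written with
  \<open>- t\<close> so that the estimate for a single phase applies to it at the reversed
  time.\<close>

lemma dirac_evolution_fourier:
  assumes m: "m > 0" and dirac: "dirac_matrices \<alpha> \<beta>" and \<psi>: "\<psi> \<in> L2_fields"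
  obtains f g where "f \<in> L2_fields" "g \<in> L2_fields"
    "\<And>t. dirac_evolution \<alpha> \<beta> m t \<psi> \<in> L2_fields"
    "\<And>t. AE p in lborel. fourier (dirac_evolution \<alpha> \<beta> m t \<psi>) p =
      exp (\<i> * of_real (t * energy m p)) *s f p + exp (\<i> * of_real (- t * energy m p)) *s g p"
proof -
  let ?h = "\<lambda>p. (1 / energy m p) *\<^sub>R dirac_symbol \<alpha> \<beta> m p"
  define f where "f p = (1/2) *\<^sub>R (fourier \<psi> p + ?h p *v fourier \<psi> p)" for p
  define g where "g p = (1/2) *\<^sub>R (fourier \<psi> p - ?h p *v fourier \<psi> p)" for p
  have F: "fourier \<psi> \<in> L2_fields" by (rule fourier_L2[OF \<psi>])
  have f: "f \<in> L2_fields" and g: "g \<in> L2_fields"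
    unfolding f_def g_def
    by (intro L2_fields_scaleR L2_fields_add L2_fields_diff L2_dirac_symbol F m)+
  have eq: "matrix_exp (mat (\<i> * of_real t) ** dirac_symbol \<alpha> \<beta> m p) *v fourier \<psi> p =
      exp (\<i> * of_real (t * energy m p)) *s f p + exp (\<i> * of_real (- t * energy m p)) *s g p" for t p
  proof -
    have "energy m p \<noteq> 0" using energy_pos[OF m, of p] by simp
    note e = matrix_exp_involution[OF this dirac_symbol_square[OF dirac], of "\<i> * of_real t"]
    have s: "(r *\<^sub>R A) *v x = r *\<^sub>R (A *v x)" for r and A :: "complex^4^4" and x
      by (simp add: vec_eq_iff matrix_vector_mult_def scaleR_sum_right)
    show ?thesis
      unfolding e matrix_vector_mult_add_rdistrib mat_mult_vec s[of "1/2"]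
        matrix_vector_mult_diff_rdistrib matrix_vector_mul_lid
      by (simp add: f_def g_def mult.assoc)
  qed
  have EL: "(\<lambda>p. exp (\<i> * of_real (r * energy m p)) *s h p) \<in> L2_fields" if "h \<in> L2_fields" for r h
    by (rule L2_unimodular_smult(1)[OF that]) simp_all
  have "(\<lambda>p. matrix_exp (mat (\<i> * of_real t) ** dirac_symbol \<alpha> \<beta> m p) *v fourier \<psi> p) \<in> L2_fields" for t
    unfolding eq by (intro L2_fields_add EL f g)
  note spec = fourier_multiplier_spec[OF this, folded dirac_evolution_def]
  show ?thesis
    by (rule that[OF f g spec(1)]) (use spec(2) in \<open>simp only: eq\<close>)
qed

section \<open>Both signs of the energy together\<close>

theorem mainTheorem4:
  fixes \<alpha> :: "3 \<Rightarrow> complex^4^4" and \<beta> :: "complex^4^4" and m \<epsilon> :: real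
    and \<psi> :: spinor_field
  assumes "m > 0" and "dirac_matrices \<alpha> \<beta>"
    and "\<psi> \<in> L2_fields" and "\<epsilon> > 0"
  shows "(\<exists>v \<tau>. 0 < v \<and> v < 1 \<and> \<tau> > 0 \<and>
            (\<forall>t. \<bar>t\<bar> \<ge> \<tau> \<longrightarrow>
               L2_norm (\<lambda>x. indicator (cball 0 (v * \<bar>t\<bar>)) x *\<^sub>R dirac_evolution \<alpha> \<beta> m t \<psi> x) \<le> \<epsilon>)) \<and>
         (\<forall>r>0. L2_tendsto
            (\<lambda>t x. indicator (cball 0 r) x *\<^sub>R dirac_evolution \<alpha> \<beta> m t \<psi> x) (\<lambda>x. 0) at_infinity)"
proof -
  let ?\<psi> = "\<lambda>t. dirac_evolution \<alpha> \<beta> m t \<psi>"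
  obtain f g where f: "f \<in> L2_fields" and g: "g \<in> L2_fields" and \<psi>L: "\<And>t. ?\<psi> t \<in> L2_fields"
    and F\<psi>: "\<And>t. AE p in lborel. fourier (?\<psi> t) p =
      exp (\<i> * of_real (t * energy m p)) *s f p + exp (\<i> * of_real (- t * energy m p)) *s g p"
    using dirac_evolution_fourier[OF assms(1-3)] by blast
  have mono: "L2_norm (\<lambda>x. indicator (cball 0 r) x *\<^sub>R u x) \<le> L2_norm (\<lambda>x. indicator (cball 0 s) x *\<^sub>R u x)"
    if u: "u \<in> L2_fields" and "r \<le> s" for u :: spinor_field and r s
  proof -
    have "(\<lambda>x. indicator (cball 0 r) x *\<^sub>R u x) \<in> borel_measurable borel"
      by (rule L2_fields_measurable[OF L2_indicator(1)[OF u]]) simp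
    moreover have "AE x in lborel. norm (indicator (cball 0 r) x *\<^sub>R u x) \<le> 1 * norm (indicator (cball 0 s) x *\<^sub>R u x)"
      using that(2) by (intro AE_I2) (auto split: split_indicator)
    ultimately have "L2_norm (\<lambda>x. indicator (cball 0 r) x *\<^sub>R u x) \<le> 1 * L2_norm (\<lambda>x. indicator (cball 0 s) x *\<^sub>R u x)"
      by (rule L2_dominated(2)[OF L2_indicator(1)[OF u borel_closed[OF closed_cball]]]) simp
    then show ?thesis by simp
  qed
  have escape: "\<exists>v \<tau>. 0 < v \<and> v < 1 \<and> \<tau> > 0 \<and>
      (\<forall>t. \<bar>t\<bar> \<ge> \<tau> \<longrightarrow> L2_norm (\<lambda>x. indicator (cball 0 (v * \<bar>t\<bar>)) x *\<^sub>R ?\<psi> t x) \<le> e)" if e: "e > 0" for e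
  proof -
    have e2: "e / 2 > 0" using e by simp
    obtain v \<tau> where v: "0 < v" "v < 1" "\<tau> > 0"
      and esc: "\<And>t u. \<bar>t\<bar> \<ge> \<tau> \<Longrightarrow> u \<in> L2_fields \<Longrightarrow>
        (AE p in lborel. fourier u p = exp (\<i> * of_real (t * energy m p)) *s f p) \<Longrightarrow>
        L2_norm (\<lambda>x. indicator (cball 0 (v * \<bar>t\<bar>)) x *\<^sub>R u x) \<le> e / 2"
      using phase_escapes_ball[OF assms(1) f e2] by blast
    obtain v' \<tau>' where v': "0 < v'" "v' < 1" "\<tau>' > 0"
      and esc': "\<And>t u. \<bar>t\<bar> \<ge> \<tau>' \<Longrightarrow> u \<in> L2_fields \<Longrightarrow>
        (AE p in lborel. fourier u p = exp (\<i> * of_real (t * energy m p)) *s g p) \<Longrightarrow>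
        L2_norm (\<lambda>x. indicator (cball 0 (v' * \<bar>t\<bar>)) x *\<^sub>R u x) \<le> e / 2"
      using phase_escapes_ball[OF assms(1) g e2] by blast
    have "L2_norm (\<lambda>x. indicator (cball 0 (min v v' * \<bar>t\<bar>)) x *\<^sub>R ?\<psi> t x) \<le> e"
      if t: "\<bar>t\<bar> \<ge> max \<tau> \<tau>'" for t
    proof -
      have fE: "(\<lambda>p. exp (\<i> * of_real (t * energy m p)) *s f p) \<in> L2_fields"
        by (rule L2_unimodular_smult(1)[OF f]) simp_all
      obtain u where u: "u \<in> L2_fields"
        and Fu: "AE p in lborel. fourier u p = exp (\<i> * of_real (t * energy m p)) *s f p"
        using fourier_surj[OF fE] by blast
      \<comment> \<open>With the positive energy part \<open>u\<close> subtracted, what remains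
        evolves by the single phase at time \<open>- t\<close>. The ball sees only the modulus of
        the time, so \<open>esc'\<close> bounds \<open>w\<close> on it; the smaller of the two
        speeds fits both parts.\<close>
      define w where "w x = ?\<psi> t x - u x" for x
      have w: "w \<in> L2_fields" unfolding w_def by (rule L2_fields_diff[OF \<psi>L u])
      have Fw: "AE p in lborel. fourier w p = exp (\<i> * of_real (- t * energy m p)) *s g p"
        using fourier_diff[OF \<psi>L[of t] u] Fu F\<psi>[of t] unfolding w_def by eventually_elim simp
      let ?B = "cball (0::real^3) (min v v' * \<bar>t\<bar>)"
      have B: "?B \<in> sets borel" by simp
      have "L2_norm (\<lambda>x. indicator ?B x *\<^sub>R u x) \<le> L2_norm (\<lambda>x. indicator (cball 0 (v * \<bar>t\<bar>)) x *\<^sub>R u x)"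
        by (rule mono[OF u]) (simp add: mult_right_mono)
      also have "\<dots> \<le> e / 2" by (rule esc[OF _ u Fu]) (use t in simp)
      finally have uB: "L2_norm (\<lambda>x. indicator ?B x *\<^sub>R u x) \<le> e / 2" .
      have "L2_norm (\<lambda>x. indicator ?B x *\<^sub>R w x) \<le> L2_norm (\<lambda>x. indicator (cball 0 (v' * \<bar>- t\<bar>)) x *\<^sub>R w x)"
        by (rule mono[OF w]) (simp add: mult_right_mono)
      also have "\<dots> \<le> e / 2" by (rule esc'[OF _ w Fw]) (use t in simp)
      finally have wB: "L2_norm (\<lambda>x. indicator ?B x *\<^sub>R w x) \<le> e / 2" .
      have "L2_norm (\<lambda>x. indicator ?B x *\<^sub>R ?\<psi> t x) \<le>
          L2_norm (\<lambda>x. indicator ?B x *\<^sub>R u x) + L2_norm (\<lambda>x. indicator ?B x *\<^sub>R w x)"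
        using L2_norm_triangle[OF L2_indicator(1)[OF u B] L2_indicator(1)[OF w B]]
        by (simp add: w_def scaleR_diff_right)
      then show ?thesis using uB wB by simp
    qed
    then show ?thesis
      using v v' by (intro exI[of _ "min v v'"] exI[of _ "max \<tau> \<tau>'"]) auto
  qed
  have "L2_tendsto (\<lambda>t x. indicator (cball 0 r) x *\<^sub>R ?\<psi> t x) (\<lambda>x. 0) at_infinity" if r: "r > 0" for r
    unfolding L2_tendsto_def
  proof (intro conjI allI)
    show "(\<lambda>x. indicator (cball 0 r) x *\<^sub>R ?\<psi> t x) \<in> L2_fields" for t
      by (rule L2_indicator(1)[OF \<psi>L]) simp
    show "(\<lambda>x. 0) \<in> L2_fields" by (rule L2_fields_zero)
    show "((\<lambda>t. L2_norm (\<lambda>x. indicator (cball 0 r) x *\<^sub>R ?\<psi> t x - 0)) \<longlongrightarrow> 0) at_infinity"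
    proof (rule tendstoI)
      fix e :: real assume "e > 0"
      \<comment> \<open>The half turns the nonstrict bound of \<open>escape\<close> into the strict
        one required for convergence.\<close>
      then have e2: "e / 2 > 0" by simp
      obtain v \<tau> where v: "0 < v" "\<tau> > 0"
        and esc: "\<And>t. \<bar>t\<bar> \<ge> \<tau> \<Longrightarrow> L2_norm (\<lambda>x. indicator (cball 0 (v * \<bar>t\<bar>)) x *\<^sub>R ?\<psi> t x) \<le> e / 2"
        using escape[OF e2] by blast
      \<comment> \<open>From time \<open>r / v\<close> on, the expanding ball contains the fixed
        ball of radius \<open>r\<close>.\<close>
      have "L2_norm (\<lambda>x. indicator (cball 0 r) x *\<^sub>R ?\<psi> t x) < e" if t: "\<bar>t\<bar> \<ge> max \<tau> (r / v)" for t
      proof -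
        have "r \<le> v * \<bar>t\<bar>" using t v by (simp add: field_simps)
        from mono[OF \<psi>L[of t] this] esc[of t] t \<open>e > 0\<close> show ?thesis by simp
      qed
      then show "\<forall>\<^sub>F t in at_infinity. dist (L2_norm (\<lambda>x. indicator (cball 0 r) x *\<^sub>R ?\<psi> t x - 0)) 0 < e"
        unfolding eventually_at_infinity by (intro exI[of _ "max \<tau> (r / v)"]) simp
    qed
  qed
  with escape[OF assms(4)] show ?thesis by blast
qed

end
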